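(* Let $\underline\lambda,\overline\lambda\in\mathbb{R}_{\ge 0}$ with $\underline\lambda\le\overline\lambda$. For a stopping time $\tau$, let $$\rho_\tau\colon\{\tau<+\infty\}\to[0,+\infty]\colon\omega\mapsto\inf\{r\in(\tau(\omega),+\infty):\omega(r)>\omega(\tau(\omega))\}$$ (with $\inf\emptyset=+\infty$). Then for every stopping time $\tau$, $$\overline{\mathrm E}_{[\underline\lambda,\overline\lambda]}[\rho_\tau-\tau\mid\tau]=\frac{1}{\underline\lambda}\quad\text{and}\quad\underline{\mathrm E}_{[\underline\lambda,\overline\lambda]}[\rho_\tau-\tau\mid\tau]=\frac{1}{\overline\lambda}$$ (equalities holding at every $\omega\in\{\tau<+\infty\}$), with the convention $1/0=+\infty$.
   Context: Conventions: $\mathbb{N}=\{1,2,\dots\}$; $\mathbb{R}_{\ge 0}=[0,+\infty)$; $\overline{\mathbb{R}}=\mathbb{R}\cup\{-\infty,+\infty\}$ with $+\infty-\infty=+\infty$; $\inf\emptyset=+\infty$; "increasing" means nondecreasing. Paths and variables. $\Omega$ is the set of counting paths: maps $\omega\colon\mathbb{R}_{\ge 0}\to\mathbb{Z}_{\ge 0}$ with $\omega(0)=0$ that are nondecreasing with unit jumps (every jump has size $1$) and right-continuous. A (partial) extended real variable is a map from (a subset of) $\Omega$ to $\overline{\mathbb{R}}$; "real" means it takes values in $\mathbb{R}$. For $t\in\mathbb{R}_{\ge 0}$, $N_t(\omega)=\omega(t)$. A stopping time is a map $\tau\colon\Omega\to[0,+\infty]$ such that for all $\omega_1,\omega_2\in\Omega$,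 if $\omega_1,\omega_2$ agree on $[0,\tau(\omega_1)]\cap\mathbb{R}_{\ge 0}$ then $\tau(\omega_1)=\tau(\omega_2)$; every $t\in\mathbb{R}_{\ge 0}$ is identified with the constant stopping time $t$. For a real-valued stopping time $\sigma$, $N_\sigma(\omega)=\omega(\sigma(\omega))$. For a stopping time $\tau$ and $\omega\in\Omega$, $\mathcal{I}_\tau(\omega)$ is the set of $\varpi\in\Omega$ that agree with $\omega$ on $[0,\tau(\omega)]\cap\mathbb{R}_{\ge 0}$. A partial variable $f$ is $\tau$-measurable if $f(\omega_1)=f(\omega_2)$ for all $\omega_1,\omega_2\in\operatorname{dom}f$ that agree on $[0,\tau(\omega_1)]\cap\mathbb{R}_{\ge 0}$. $\{\tau<+\infty\}=\{\omega\in\Omega:\tau(\omega)<+\infty\}$, and $\overline{\mathbb{V}}_\tau$ is the set of extended real partial variables whose domain includes $\{\tau<+\infty\}$. A process is a family $\mathcal{S}_\bullet=(\mathcal{S}_t)_{t\in\mathbb{R}_{\ge 0}}$ of real variables on $\Omega$ with $\mathcal{S}_t$ $t$-measurable for all $t$; $\inf\mathcal{S}_\bullet=\inf_{t,\omega}\mathcal{S}_t(\omega)$; $\mathcal{S}_\tau(\omega)=\mathcal{S}_{\tau(\omega)}(\omega)$ for $\omega\in\{\tau<+\infty\}$; $\liminf\mathcal{S}_\bullet(\omega)=\liminf_{t\to+\infty}\mathcal{S}_t(\omega)$. Capital processes. A one-sided elementary trading strategy $G$ consists of finitely many stopping times $\tau_1\le\tau_2\le\cdots\le\tau_{n+1}$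 ($n\in\mathbb{N}$) and stakes $\overline h_1,\underline h_1,\dots,\overline h_n,\underline h_n$, where $\overline h_k,\underline h_k$ are $\tau_k$-measurable bounded nonnegative real (possibly partial) variables whose domains include $\{\tau_k<+\infty\}$. With initial capital $c\in\mathbb{R}$ its capital process is $$\mathcal{K}^{G,c}_t=c+\sum_{k=1}^n\Big(\overline h_k\big(N_{\tau_{k+1}\wedge t}-N_{\tau_k\wedge t}-\overline\lambda(\tau_{k+1}\wedge t-\tau_k\wedge t)\big)+\underline h_k\big(\underline\lambda(\tau_{k+1}\wedge t-\tau_k\wedge t)-N_{\tau_{k+1}\wedge t}+N_{\tau_k\wedge t}\big)\Big),$$ where terms with $\tau_k(\omega)\wedge t=\tau_{k+1}(\omega)\wedge t$ count as zero. $\mathfrak{K}_{[\underline\lambda,\overline\lambda]}$ is the set of all such processes $\mathcal{K}^{G,c}_\bullet$. Upper and lower expectation. For a stopping time $\tau$, $f\in\overline{\mathbb{V}}_\tau$ and $\omega\in\{\tau<+\infty\}$, $$\overline{\mathrm E}_{[\underline\lambda,\overline\lambda]}[f\mid\tau](\omega)=\inf\{\mathcal{K}_\tau(\omega):\mathcal{K}_\bullet\in\mathfrak{K}_{[\underline\lambda,\overline\lambda]},\ \inf\mathcal{K}_\bullet>-\infty,\ \liminf\mathcal{K}_\bullet(\varpi)\ge f(\varpi)\ \forall\varpi\in\mathcal{I}_\tau(\omega)\},$$ and $\underline{\mathrm E}_{[\underline\lambda,\overline\lambda]}[f\mid\tau](\omega)=-\overline{\mathrm E}_{[\underline\lambda,\overline\lambda]}[-f\mid\tau](\omega)$.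 *)

theory Defs
  imports "HOL-Analysis.Analysis"
begin

text \<open>
  Functions on the half-line are represented by functions on the type of reals that are
  \<open>undefined\<close> at negative arguments, so that equality of paths is equality on \<open>{0..}\<close>.
  The last clause says that the left limit exists at every positive time and that the
  jump there is 0 or 1.
\<close>

definition is_counting_path :: "(real \<Rightarrow> nat) \<Rightarrow> bool" where
  "is_counting_path w \<longleftrightarrow>
     w \<in> extensional {0..} \<and>
     w 0 = 0 \<and>
     mono_on {0..} w \<and>
     (\<forall>t\<ge>0. continuous (at_right t) w) \<and>
     (\<forall>t>0. \<exists>l. (w \<longlongrightarrow> l) (at_left t) \<and> (w t = l \<or> w t = l + 1))"

lemma is_counting_path_zero: "is_counting_path (restrict (\<lambda>_. 0) {0..})"
proof -
  let ?z = "restrict (\<lambda>_. 0 :: nat) {0 :: real..}"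
  have "continuous (at_right t) ?z" if "t \<ge> 0" for t :: real
  proof -
    have "eventually (\<lambda>s. ?z s = 0) (at_right t)"
      by (rule eventually_mono[OF eventually_at_right_less]) (use that in auto)
    then have "(?z \<longlongrightarrow> 0) (at_right t)"
      by (rule tendsto_eventually)
    with that show ?thesis
      by (simp add: continuous_within)
  qed
  moreover have "(?z \<longlongrightarrow> 0) (at_left t)" if "t > 0" for t :: real
  proof -
    have "eventually (\<lambda>s. s \<in> {0<..<t}) (at_left t)"
      by (rule eventually_at_leftI[OF _ that])
    then have "eventually (\<lambda>s. ?z s = 0) (at_left t)"
      by (rule eventually_mono) auto
    then show ?thesis
      by (rule tendsto_eventually)
  qed
  ultimately show ?thesis
    by (auto simp: is_counting_path_def mono_on_def intro!: exI[of _ 0])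
qed

typedef path = "{w :: real \<Rightarrow> nat. is_counting_path w}"
  morphisms path_fun Abs_path
  using is_counting_path_zero by blast

definition N :: "real \<Rightarrow> path \<Rightarrow> nat" where
  "N t \<omega> = path_fun \<omega> t"

text \<open>
  Partial variables are maps, that is, functions of type \<open>path \<rightharpoonup> ereal\<close> or \<open>path \<rightharpoonup> real\<close>.
  In the type \<^typ>\<open>ereal\<close> we have \<open>\<infinity> - \<infinity> = \<infinity>\<close>, \<open>Inf {} = \<infinity>\<close> and \<open>1 / 0 = \<infinity>\<close>.
\<close>

definition agree_upto :: "ereal \<Rightarrow> path \<Rightarrow> path \<Rightarrow> bool" where
  "agree_upto T \<omega>1 \<omega>2 \<longleftrightarrow> (\<forall>t\<ge>0. ereal t \<le> T \<longrightarrow> N t \<omega>1 = N t \<omega>2)"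

definition stopping_time :: "(path \<Rightarrow> ereal) \<Rightarrow> bool" where
  "stopping_time \<tau> \<longleftrightarrow>
     (\<forall>\<omega>. 0 \<le> \<tau> \<omega>) \<and>
     (\<forall>\<omega>1 \<omega>2. agree_upto (\<tau> \<omega>1) \<omega>1 \<omega>2 \<longrightarrow> \<tau> \<omega>1 = \<tau> \<omega>2)"

definition finite_event :: "(path \<Rightarrow> ereal) \<Rightarrow> path set" where
  "finite_event \<tau> = {\<omega>. \<tau> \<omega> < \<infinity>}"

definition info_set :: "(path \<Rightarrow> ereal) \<Rightarrow> path \<Rightarrow> path set" where
  "info_set \<tau> \<omega> = {\<omega>'. agree_upto (\<tau> \<omega>) \<omega> \<omega>'}"

definition measurable_at :: "(path \<Rightarrow> ereal) \<Rightarrow> (path \<rightharpoonup> 'a) \<Rightarrow> bool" where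
  "measurable_at \<tau> f \<longleftrightarrow>
     (\<forall>\<omega>1\<in>dom f. \<forall>\<omega>2\<in>dom f. agree_upto (\<tau> \<omega>1) \<omega>1 \<omega>2 \<longrightarrow> f \<omega>1 = f \<omega>2)"

definition variables_from :: "(path \<Rightarrow> ereal) \<Rightarrow> (path \<rightharpoonup> ereal) set" where
  "variables_from \<tau> = {f. finite_event \<tau> \<subseteq> dom f}"

definition is_stake :: "(path \<Rightarrow> ereal) \<Rightarrow> (path \<rightharpoonup> real) \<Rightarrow> bool" where
  "is_stake \<tau> h \<longleftrightarrow>
     finite_event \<tau> \<subseteq> dom h \<and> measurable_at \<tau> h \<and> (\<forall>x\<in>ran h. 0 \<le> x) \<and> bounded (ran h)"

text \<open>
  In a strategy \<open>G\<close> only the stopping times with index in \<open>{1..rounds G + 1}\<close> and the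
  stakes with index in \<open>{1..rounds G}\<close> are relevant.
\<close>

record strategy =
  rounds :: nat
  times :: "nat \<Rightarrow> path \<Rightarrow> ereal"
  upper_stake :: "nat \<Rightarrow> path \<rightharpoonup> real"
  lower_stake :: "nat \<Rightarrow> path \<rightharpoonup> real"

definition elementary_strategy :: "strategy \<Rightarrow> bool" where
  "elementary_strategy G \<longleftrightarrow>
     1 \<le> rounds G \<and>
     (\<forall>k\<in>{1..rounds G + 1}. stopping_time (times G k)) \<and>
     (\<forall>k\<in>{1..rounds G}. \<forall>\<omega>. times G k \<omega> \<le> times G (k + 1) \<omega>) \<and>
     (\<forall>k\<in>{1..rounds G}. is_stake (times G k) (upper_stake G k)
                       \<and> is_stake (times G k) (lower_stake G k))"

definition stopped :: "(path \<Rightarrow> ereal) \<Rightarrow> real \<Rightarrow> path \<Rightarrow> real" where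
  "stopped \<tau> t \<omega> = real_of_ereal (min (\<tau> \<omega>) (ereal t))"

text \<open>
  For \<open>t \<ge> 0\<close> the two cut-off times \<open>a\<close> and \<open>b\<close> below can only differ if the stopping time
  \<open>times G k\<close> is finite on \<open>\<omega>\<close>, in which case both stakes are defined there.
\<close>

definition round_gain ::
  "real \<Rightarrow> real \<Rightarrow> strategy \<Rightarrow> nat \<Rightarrow> real \<Rightarrow> path \<Rightarrow> real" where
  "round_gain lam_lo lam_hi G k t \<omega> =
     (let a = stopped (times G k) t \<omega>; b = stopped (times G (k + 1)) t \<omega> in
      if a = b then 0
      else the (upper_stake G k \<omega>) * (real (N b \<omega>) - real (N a \<omega>) - lam_hi * (b - a))
         + the (lower_stake G k \<omega>) * (lam_lo * (b - a) - real (N b \<omega>) + real (N a \<omega>)))"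

definition capital ::
  "real \<Rightarrow> real \<Rightarrow> strategy \<Rightarrow> real \<Rightarrow> real \<Rightarrow> path \<Rightarrow> real" where
  "capital lam_lo lam_hi G c t \<omega> =
     c + (\<Sum>k = 1..rounds G. round_gain lam_lo lam_hi G k t \<omega>)"

definition capital_processes :: "real \<Rightarrow> real \<Rightarrow> (real \<Rightarrow> path \<Rightarrow> real) set" where
  "capital_processes lam_lo lam_hi =
     {capital lam_lo lam_hi G c | G c. elementary_strategy G}"

definition process_inf :: "(real \<Rightarrow> path \<Rightarrow> real) \<Rightarrow> ereal" where
  "process_inf S = (INF (t, \<omega>)\<in>{0..} \<times> UNIV. ereal (S t \<omega>))"

definition process_liminf :: "(real \<Rightarrow> path \<Rightarrow> real) \<Rightarrow> path \<Rightarrow> ereal" where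
  "process_liminf S \<omega> = Liminf at_top (\<lambda>t. ereal (S t \<omega>))"

definition process_at :: "(real \<Rightarrow> path \<Rightarrow> real) \<Rightarrow> (path \<Rightarrow> ereal) \<Rightarrow> path \<Rightarrow> real" where
  "process_at S \<tau> \<omega> = S (real_of_ereal (\<tau> \<omega>)) \<omega>"

text \<open>
  The two expectations are meaningful for \<open>f \<in> variables_from \<tau>\<close> and \<open>\<omega> \<in> finite_event \<tau>\<close>;
  then \<open>info_set \<tau> \<omega> \<subseteq> dom f\<close> whenever \<open>\<tau>\<close> is a stopping time.
\<close>

definition upper_expectation ::
  "real \<Rightarrow> real \<Rightarrow> (path \<rightharpoonup> ereal) \<Rightarrow> (path \<Rightarrow> ereal) \<Rightarrow> path \<Rightarrow> ereal" where
  "upper_expectation lam_lo lam_hi f \<tau> \<omega> =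
     Inf {ereal (process_at K \<tau> \<omega>) | K.
            K \<in> capital_processes lam_lo lam_hi \<and> process_inf K > -\<infinity> \<and>
            (\<forall>\<omega>'\<in>info_set \<tau> \<omega>. process_liminf K \<omega>' \<ge> the (f \<omega>'))}"

definition lower_expectation ::
  "real \<Rightarrow> real \<Rightarrow> (path \<rightharpoonup> ereal) \<Rightarrow> (path \<Rightarrow> ereal) \<Rightarrow> path \<Rightarrow> ereal" where
  "lower_expectation lam_lo lam_hi f \<tau> \<omega> =
     - upper_expectation lam_lo lam_hi (\<lambda>\<omega>'. map_option uminus (f \<omega>')) \<tau> \<omega>"

definition next_jump :: "(path \<Rightarrow> ereal) \<Rightarrow> path \<rightharpoonup> ereal" where
  "next_jump \<tau> \<omega> =
     (if \<omega> \<in> finite_event \<tau>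
      then Some (Inf {ereal r | r. \<tau> \<omega> < ereal r \<and> N r \<omega> > N (real_of_ereal (\<tau> \<omega>)) \<omega>})
      else None)"

definition waiting_time :: "(path \<Rightarrow> ereal) \<Rightarrow> path \<rightharpoonup> ereal" where
  "waiting_time \<tau> \<omega> = map_option (\<lambda>r. r - \<tau> \<omega>) (next_jump \<tau> \<omega>)"

lemma waiting_time_in_variables_from: "waiting_time \<tau> \<in> variables_from \<tau>"
  by (auto simp: variables_from_def waiting_time_def next_jump_def)

lemma info_set_subset_finite_event:
  assumes "stopping_time \<tau>" "\<omega> \<in> finite_event \<tau>"
  shows "info_set \<tau> \<omega> \<subseteq> finite_event \<tau>"
  using assms by (force simp: stopping_time_def finite_event_def info_set_def)

end

theory Submission
  imports Defs "HOL-Real_Asymp.Real_Asymp"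
begin

text \<open>
  Write \<open>s\<close> for the value of the stopping time, \<open>lo\<close> and \<open>hi\<close> for the two rates, and \<open>\<rho>\<close> for the
  first jump after \<open>s\<close>. A Poisson process of rate \<open>\<mu>\<close> waits \<open>1 / \<mu>\<close> on average for its next jump,
  and every \<open>\<mu>\<close> in \<open>[lo, hi]\<close> is compatible with the bets on offer; the extreme rates give the two
  expectations.

  The upper bounds are explicit bets. Holding the lower stake \<open>1 / lo\<close> from \<open>s\<close> to \<open>\<rho>\<close>
  turns the initial capital \<open>1 / lo\<close> into \<open>\<rho> - s\<close> exactly. To superhedge \<open>s - \<rho>\<close> one would hold
  the upper stake \<open>1 / hi\<close> up to \<open>\<rho>\<close>, but then the capital decreases without bound as long as no
  jump occurs. Stopping at the deadline \<open>s + T\<close> keeps it bounded; with the stake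
  \<open>h = T / (1 + hi * T)\<close> the initial capital \<open>-h\<close> suffices, and \<open>h\<close> tends to \<open>1 / hi\<close> as \<open>T\<close> grows.

  For the lower bounds one needs no measure on paths, because up to the first jump a strategy
  acts on a single path, the one frozen at time \<open>s\<close>. Let \<open>g t\<close> be the capital on that path.
  If a first jump occurs at time \<open>u\<close>, then the capital becomes \<open>J u = g u + H u\<close>, where \<open>H u\<close> is the net
  stake held just before \<open>u\<close> (\<open>capital_one_jump\<close>). From there on, the path can be continued so
  that the capital never rises by more than a given \<open>\<epsilon>\<close> (\<open>no_arbitrage\<close>). A superhedge
  of \<open>\<sigma> * (\<rho> - s)\<close>, with \<open>\<sigma> = 1\<close> or \<open>\<sigma> = -1\<close>, therefore has \<open>J u \<ge> \<sigma> * (u - s)\<close> for all \<open>u > s\<close>.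
  On the other hand, apart from finitely many times, \<open>g' \<le> - \<mu> * H = \<mu> * (g - J)\<close> for every \<open>\<mu>\<close> in
  \<open>[lo, hi]\<close>. This differential inequality and a lower bound of \<open>g\<close> imply \<open>g s \<ge> \<sigma> / \<mu>\<close> when
  \<open>\<mu> > 0\<close> (\<open>capital_ge_of_jump_bound\<close>). Taking \<open>\<mu> = lo\<close> for \<open>\<sigma> = 1\<close> and \<open>\<mu> = hi\<close> for \<open>\<sigma> = -1\<close> gives
  the two bounds. If \<open>lo = 0\<close>, then \<open>g\<close> is nonincreasing, so it cannot reach the infinite waiting
  time of the frozen path, and \<open>\<rho> - s\<close> has no superhedge at all.
\<close>

section \<open>Counting paths\<close>

lemma eventually_at_right_iff_real:
  "eventually P (at_right (t::real)) \<longleftrightarrow> (\<exists>b>t. \<forall>u. t < u \<and> u < b \<longrightarrow> P u)"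
  by (auto simp: eventually_at_right_field)

lemma eventually_at_left_iff_real:
  "eventually P (at_left (t::real)) \<longleftrightarrow> (\<exists>b<t. \<forall>u. b < u \<and> u < t \<longrightarrow> P u)"
  by (auto simp: eventually_at_left_field)

lemma is_counting_path_N: "is_counting_path (\<lambda>t. N t \<omega>)"
  using path_fun[of \<omega>] by (simp add: N_def)

lemma N_mono: "0 \<le> s \<Longrightarrow> s \<le> t \<Longrightarrow> N s \<omega> \<le> N t \<omega>"
  using is_counting_path_N[of \<omega>] by (auto simp: is_counting_path_def mono_on_def)

lemma N_locally_constant_right:
  assumes "0 \<le> t"
  obtains b where "b > t" "\<And>u. t < u \<Longrightarrow> u < b \<Longrightarrow> N u \<omega> = N t \<omega>"
proof -
  have "((\<lambda>u. N u \<omega>) \<longlongrightarrow> N t \<omega>) (at_right t)"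
    using is_counting_path_N[of \<omega>] assms
    by (simp add: is_counting_path_def continuous_within)
  then obtain b where "b > t" "\<forall>u. t < u \<and> u < b \<longrightarrow> N u \<omega> = N t \<omega>"
    by (auto simp: tendsto_discrete eventually_at_right_iff_real)
  then show ?thesis
    by (intro that[of b]) auto
qed

lemma N_locally_constant_left:
  assumes "0 < t"
  obtains l b where "b < t" "\<And>u. b < u \<Longrightarrow> u < t \<Longrightarrow> N u \<omega> = l"
    "N t \<omega> = l \<or> N t \<omega> = l + 1"
proof -
  obtain l where "((\<lambda>u. N u \<omega>) \<longlongrightarrow> l) (at_left t)" and l: "N t \<omega> = l \<or> N t \<omega> = l + 1"
    using is_counting_path_N[of \<omega>] assms by (auto simp: is_counting_path_def)
  then obtain b where "b < t" "\<forall>u. b < u \<and> u < t \<longrightarrow> N u \<omega> = l"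
    by (auto simp: tendsto_discrete eventually_at_left_iff_real)
  with l show ?thesis
    by (intro that[of b l]) auto
qed

lemma is_counting_pathI:
  assumes "w \<in> extensional {0..}" "w 0 = 0"
    and "\<And>s t. 0 \<le> s \<Longrightarrow> s \<le> t \<Longrightarrow> w s \<le> w t"
    and right: "\<And>t. 0 \<le> t \<Longrightarrow> \<exists>b>t. \<forall>u. t < u \<and> u < b \<longrightarrow> w u = w t"
    and left: "\<And>t. 0 < t \<Longrightarrow> \<exists>l. (\<exists>b<t. \<forall>u. b < u \<and> u < t \<longrightarrow> w u = l) \<and> (w t = l \<or> w t = l + 1)"
  shows "is_counting_path w"
  unfolding is_counting_path_def continuous_within tendsto_discrete
    eventually_at_right_iff_real eventually_at_left_iff_real
  using assms by (simp add: mono_on_def)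

text \<open>
  The path is kept up to time \<open>a\<close> and then jumps at \<open>a + 1 / r\<close>, \<open>a + 2 / r\<close>, and so on. The
  rate \<open>0\<close> freezes the path at time \<open>a\<close>, and the rate \<open>1 / (u - a)\<close> makes \<open>u\<close> its first jump
  after \<open>a\<close>. All paths on which strategies are tested below arise in this way.
\<close>

definition continue_at_rate :: "real \<Rightarrow> real \<Rightarrow> path \<Rightarrow> path" where
  "continue_at_rate a r \<omega> =
     Abs_path (restrict (\<lambda>t. if t \<le> a then N t \<omega> else N a \<omega> + nat \<lfloor>r * (t - a)\<rfloor>) {0..})"

lemma nat_floor_locally_constant_right:
  fixes a r t :: real
  assumes "0 \<le> r"
  shows "\<exists>b>t. \<forall>u. t < u \<and> u < b \<longrightarrow> nat \<lfloor>r * (u - a)\<rfloor> = nat \<lfloor>r * (t - a)\<rfloor>"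
proof (cases "r = 0")
  case True
  then show ?thesis by (auto intro: exI[of _ "t + 1"])
next
  case False
  with assms have "r > 0" by simp
  define m where "m = \<lfloor>r * (t - a)\<rfloor>"
  define b where "b = a + (of_int m + 1) / r"
  have m: "of_int m \<le> r * (t - a)" "r * (t - a) < of_int m + 1"
    by (auto simp: m_def)
  then have "b > t"
    using \<open>r > 0\<close> by (simp add: b_def field_simps)
  moreover have "\<lfloor>r * (u - a)\<rfloor> = m" if "t < u" "u < b" for u
  proof (rule floor_unique)
    have "r * (t - a) \<le> r * (u - a)"
      using that \<open>r > 0\<close> by simp
    with m show "of_int m \<le> r * (u - a)" by linarith
    show "r * (u - a) < of_int m + 1"
      using that \<open>r > 0\<close> by (simp add: b_def field_simps)
  qed
  ultimately show ?thesis
    by (auto simp: m_def)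
qed

lemma nat_floor_locally_constant_left:
  fixes a r t :: real
  assumes "0 \<le> r" "a < t"
  shows "\<exists>l. (\<exists>b<t. \<forall>u. b < u \<and> u < t \<longrightarrow> nat \<lfloor>r * (u - a)\<rfloor> = l) \<and>
             (nat \<lfloor>r * (t - a)\<rfloor> = l \<or> nat \<lfloor>r * (t - a)\<rfloor> = l + 1)"
proof (cases "r = 0")
  case True
  then show ?thesis by (auto intro: exI[of _ "t - 1"])
next
  case False
  with assms have "r > 0" by simp
  define m where "m = \<lceil>r * (t - a)\<rceil> - 1"
  have m: "of_int m < r * (t - a)" "r * (t - a) \<le> of_int m + 1"
    unfolding m_def by linarith+
  have "0 < r * (t - a)"
    using assms \<open>r > 0\<close> by simp
  then have "m \<ge> 0"
    unfolding m_def by linarith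
  define b where "b = a + of_int m / r"
  have "b < t"
    using m \<open>r > 0\<close> by (simp add: b_def field_simps)
  moreover have "\<lfloor>r * (u - a)\<rfloor> = m" if "b < u" "u < t" for u
  proof (rule floor_unique)
    have "r * (u - a) < r * (t - a)"
      using that \<open>r > 0\<close> by simp
    with m show "r * (u - a) < of_int m + 1" by linarith
    show "of_int m \<le> r * (u - a)"
      using that \<open>r > 0\<close> by (simp add: b_def field_simps)
  qed
  moreover have "\<lfloor>r * (t - a)\<rfloor> = m \<or> \<lfloor>r * (t - a)\<rfloor> = m + 1"
    using m by linarith
  then have "nat \<lfloor>r * (t - a)\<rfloor> = nat m \<or> nat \<lfloor>r * (t - a)\<rfloor> = nat m + 1"
    using \<open>m \<ge> 0\<close> by auto
  ultimately show ?thesis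
    by (intro exI[of _ "nat m"]) auto
qed

lemma is_counting_path_continue_at_rate:
  assumes "0 \<le> a" "0 \<le> r"
  shows "is_counting_path
    (restrict (\<lambda>t. if t \<le> a then N t \<omega> else N a \<omega> + nat \<lfloor>r * (t - a)\<rfloor>) {0..})"
    (is "is_counting_path ?w")
proof (rule is_counting_pathI)
  show "?w \<in> extensional {0..}"
    by simp
  show "?w 0 = 0"
    using assms is_counting_path_N[of \<omega>] by (simp add: is_counting_path_def)
next
  fix s t :: real
  assume st: "0 \<le> s" "s \<le> t"
  have "nat \<lfloor>r * (s - a)\<rfloor> \<le> nat \<lfloor>r * (t - a)\<rfloor>"
    using st assms by (intro nat_mono floor_mono mult_left_mono) auto
  then show "?w s \<le> ?w t"
    using st assms N_mono[of s t \<omega>] N_mono[of s a \<omega>] by auto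
next
  fix t :: real
  assume "0 \<le> t"
  show "\<exists>b>t. \<forall>u. t < u \<and> u < b \<longrightarrow> ?w u = ?w t"
  proof (cases "t < a")
    case True
    obtain b where "b > t" "\<And>u. t < u \<Longrightarrow> u < b \<Longrightarrow> N u \<omega> = N t \<omega>"
      using N_locally_constant_right[OF \<open>0 \<le> t\<close>] by blast
    then show ?thesis
      using True \<open>0 \<le> t\<close> by (intro exI[of _ "min a b"]) auto
  next
    case False
    obtain b where "b > t"
      "\<forall>u. t < u \<and> u < b \<longrightarrow> nat \<lfloor>r * (u - a)\<rfloor> = nat \<lfloor>r * (t - a)\<rfloor>"
      using nat_floor_locally_constant_right[OF \<open>0 \<le> r\<close>] by blast
    then show ?thesis
      using False \<open>0 \<le> t\<close> by (intro exI[of _ b]) auto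
  qed
next
  fix t :: real
  assume "0 < t"
  show "\<exists>l. (\<exists>b<t. \<forall>u. b < u \<and> u < t \<longrightarrow> ?w u = l) \<and> (?w t = l \<or> ?w t = l + 1)"
  proof (cases "t \<le> a")
    case True
    obtain l b where "b < t" "\<And>u. b < u \<Longrightarrow> u < t \<Longrightarrow> N u \<omega> = l"
      "N t \<omega> = l \<or> N t \<omega> = l + 1"
      using N_locally_constant_left[OF \<open>0 < t\<close>] by blast
    then show ?thesis
      using True \<open>0 < t\<close> by (intro exI[of _ l] conjI exI[of _ "max 0 b"]) auto
  next
    case False
    then obtain l b where "b < t" "\<forall>u. b < u \<and> u < t \<longrightarrow> nat \<lfloor>r * (u - a)\<rfloor> = l"
      "nat \<lfloor>r * (t - a)\<rfloor> = l \<or> nat \<lfloor>r * (t - a)\<rfloor> = l + 1"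
      using nat_floor_locally_constant_left[OF \<open>0 \<le> r\<close>, of a t] by auto
    then show ?thesis
      using False assms \<open>0 < t\<close>
      by (intro exI[of _ "N a \<omega> + l"] conjI exI[of _ "max a b"]) auto
  qed
qed

lemma N_continue_at_rate:
  assumes "0 \<le> a" "0 \<le> r" "0 \<le> t"
  shows "N t (continue_at_rate a r \<omega>) =
    (if t \<le> a then N t \<omega> else N a \<omega> + nat \<lfloor>r * (t - a)\<rfloor>)"
  unfolding continue_at_rate_def N_def[of t "Abs_path _"]
  using is_counting_path_continue_at_rate[OF assms(1,2)] assms(3)
  by (simp add: Abs_path_inverse)

lemma agree_upto_trans: "agree_upto T \<omega>1 \<omega>2 \<Longrightarrow> agree_upto T \<omega>2 \<omega>3 \<Longrightarrow> agree_upto T \<omega>1 \<omega>3"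
  by (simp add: agree_upto_def)

lemma agree_upto_mono: "agree_upto T \<omega>1 \<omega>2 \<Longrightarrow> S \<le> T \<Longrightarrow> agree_upto S \<omega>1 \<omega>2"
  unfolding agree_upto_def by (meson order_trans)

lemma agree_upto_continue_at_rate:
  assumes "0 \<le> a" "0 \<le> r"
  shows "agree_upto (ereal a) \<omega> (continue_at_rate a r \<omega>)"
  using assms by (simp add: agree_upto_def N_continue_at_rate)

section \<open>Stopped times and gains\<close>

lemma stopping_time_nonneg: "stopping_time \<tau> \<Longrightarrow> 0 \<le> \<tau> \<omega>"
  by (simp add: stopping_time_def)

lemma stopping_time_agree:
  "stopping_time \<tau> \<Longrightarrow> agree_upto (\<tau> \<omega>1) \<omega>1 \<omega>2 \<Longrightarrow> \<tau> \<omega>2 = \<tau> \<omega>1"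
  by (metis stopping_time_def)

lemma stopped_eq:
  "stopped \<tau> t \<omega> = (if \<tau> \<omega> \<le> ereal t then real_of_ereal (\<tau> \<omega>) else t)"
  by (simp add: stopped_def min_def)

lemma ereal_stopped:
  assumes "stopping_time \<tau>"
  shows "ereal (stopped \<tau> t \<omega>) = min (\<tau> \<omega>) (ereal t)"
  using stopping_time_nonneg[OF assms, of \<omega>]
  by (cases "\<tau> \<omega>") (auto simp: stopped_def min_def)

lemma stopped_nonneg:
  assumes "stopping_time \<tau>" "0 \<le> t"
  shows "0 \<le> stopped \<tau> t \<omega>"
  using stopping_time_nonneg[OF assms(1), of \<omega>] assms(2)
  by (auto simp: stopped_eq real_of_ereal_pos)

text \<open>
  Agreement strictly before \<open>u\<close> is enough: a stopping time with a value below \<open>u\<close> is determined by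
  it, and all other values are cut off to \<open>u\<close>. This allows comparing a path that jumps at \<open>u\<close> with
  one that does not.
\<close>

lemma agree_before_imp_min_eq:
  assumes "stopping_time \<tau>"
    and agree: "\<And>r. 0 \<le> r \<Longrightarrow> r < u \<Longrightarrow> N r \<omega>1 = N r \<omega>2"
  shows "min (\<tau> \<omega>1) (ereal u) = min (\<tau> \<omega>2) (ereal u)"
proof -
  have *: "\<tau> \<omega>1 = \<tau> \<omega>2" if "\<tau> \<omega>1 < ereal u"
    and "\<And>r. 0 \<le> r \<Longrightarrow> r < u \<Longrightarrow> N r \<omega>1 = N r \<omega>2" for \<omega>1 \<omega>2
  proof -
    have "agree_upto (\<tau> \<omega>1) \<omega>1 \<omega>2"
      unfolding agree_upto_def
      using that by (metis ereal_less(2) le_less_trans less_ereal.simps(1))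
    then show ?thesis
      using assms(1) by (simp add: stopping_time_def)
  qed
  show ?thesis
    using *[of \<omega>1 \<omega>2] *[of \<omega>2 \<omega>1] agree by (smt (verit) less_le_not_le linorder_linear min.absorb2 min_def order_antisym)
qed

lemma agree_upto_min_imp_min_eq:
  assumes "stopping_time \<tau>" "agree_upto (min (\<tau> \<omega>1) (ereal t)) \<omega>1 \<omega>2"
  shows "min (\<tau> \<omega>1) (ereal t) = min (\<tau> \<omega>2) (ereal t)"
proof (cases "\<tau> \<omega>1 \<le> ereal t")
  case True
  then show ?thesis
    using assms stopping_time_agree[of \<tau> \<omega>1 \<omega>2] by (simp add: min_def)
next
  case False
  then have "agree_upto (ereal t) \<omega>1 \<omega>2"
    using assms by (simp add: min_def)
  then show ?thesis
    by (intro agree_before_imp_min_eq assms) (simp add: agree_upto_def)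
qed

text \<open>
  The stakes are multiplied by \<open>0\<close> when the two cut-off times coincide, so the case distinction
  in the gain can be dropped whatever the value of an undefined stake.
\<close>

lemma round_gain_eq:
  "round_gain lo hi G k t \<omega> =
     (let a = stopped (times G k) t \<omega>; b = stopped (times G (k + 1)) t \<omega> in
      the (upper_stake G k \<omega>) * (real (N b \<omega>) - real (N a \<omega>) - hi * (b - a))
      + the (lower_stake G k \<omega>) * (lo * (b - a) - real (N b \<omega>) + real (N a \<omega>)))"
  by (simp add: round_gain_def Let_def)

lemma elementary_strategyD:
  assumes "elementary_strategy G" "k \<in> {1..rounds G}"
  shows "stopping_time (times G k)" "stopping_time (times G (k + 1))"
    "times G k \<omega> \<le> times G (k + 1) \<omega>"
    "is_stake (times G k) (upper_stake G k)" "is_stake (times G k) (lower_stake G k)"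
  using assms by (auto simp: elementary_strategy_def)

lemma stake_cong:
  assumes "is_stake \<tau> h" "agree_upto (\<tau> \<omega>1) \<omega>1 \<omega>2" "stopping_time \<tau>" "\<tau> \<omega>1 < \<infinity>"
  shows "h \<omega>1 = h \<omega>2"
proof -
  have "\<tau> \<omega>2 < \<infinity>"
    using assms stopping_time_agree by metis
  then have "\<omega>1 \<in> dom h" "\<omega>2 \<in> dom h"
    using assms by (auto simp: is_stake_def finite_event_def)
  then show ?thesis
    using assms by (auto simp: is_stake_def measurable_at_def)
qed

lemma stake_nonneg:
  assumes "is_stake \<tau> h" "\<tau> \<omega> < \<infinity>"
  shows "0 \<le> the (h \<omega>)"
proof -
  have "\<omega> \<in> dom h"
    using assms by (auto simp: is_stake_def finite_event_def)
  then have "the (h \<omega>) \<in> ran h"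
    by (auto simp: ran_def)
  then show ?thesis
    using assms by (auto simp: is_stake_def)
qed

lemma round_gain_cong:
  assumes G: "elementary_strategy G" and k: "k \<in> {1..rounds G}" and "0 \<le> t"
    and agree: "agree_upto (min (times G (k + 1) \<omega>1) (ereal t)) \<omega>1 \<omega>2"
  shows "round_gain lo hi G k t \<omega>1 = round_gain lo hi G k t \<omega>2"
proof -
  note D = elementary_strategyD[OF G k]
  define a b where "a = stopped (times G k) t \<omega>1" and "b = stopped (times G (k + 1)) t \<omega>1"
  have agree_a: "agree_upto (min (times G k \<omega>1) (ereal t)) \<omega>1 \<omega>2"
    by (rule agree_upto_mono[OF agree]) (use D(3)[of \<omega>1] in \<open>auto simp: min_le_iff_disj\<close>)
  have a: "stopped (times G k) t \<omega>2 = a"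
    using agree_upto_min_imp_min_eq[OF D(1) agree_a] by (simp add: a_def stopped_def)
  have b: "stopped (times G (k + 1)) t \<omega>2 = b"
    using agree_upto_min_imp_min_eq[OF D(2) agree] by (simp add: b_def stopped_def)
  have N: "N a \<omega>1 = N a \<omega>2" "N b \<omega>1 = N b \<omega>2"
    using agree agree_a stopped_nonneg[OF D(1) \<open>0 \<le> t\<close>, of \<omega>1]
      stopped_nonneg[OF D(2) \<open>0 \<le> t\<close>, of \<omega>1]
    unfolding agree_upto_def a_def b_def
      ereal_stopped[OF D(1), symmetric] ereal_stopped[OF D(2), symmetric]
    by blast+
  show ?thesis
  proof (cases "times G k \<omega>1 \<le> ereal t")
    case True
    then have "agree_upto (times G k \<omega>1) \<omega>1 \<omega>2" "times G k \<omega>1 < \<infinity>"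
      using agree_a by (auto simp: min_def)
    then have "upper_stake G k \<omega>1 = upper_stake G k \<omega>2" "lower_stake G k \<omega>1 = lower_stake G k \<omega>2"
      using D stake_cong by metis+
    then show ?thesis
      unfolding round_gain_eq a b using N by (simp add: a_def b_def Let_def)
  next
    case False
    then have "a = t" "b = t"
      using D(3)[of \<omega>1] by (auto simp: a_def b_def stopped_eq)
    then show ?thesis
      unfolding round_gain_eq a b by (simp add: a_def b_def Let_def)
  qed
qed

section \<open>No arbitrage\<close>

text \<open>
  If the upper stake dominates, then a path without jumps gains nothing. Otherwise the jumps are the
  losses, and they have to keep up with the compensator \<open>lo * x\<close>. With regular jumps at a rate
  \<open>r \<ge> lo\<close> the number of jumps lags behind by at most \<open>lo / r\<close>, the deficit just before the first
  jump; the factor \<open>1 + (low - up) / \<epsilon>\<close> in the rate makes this lag cost less than \<open>\<epsilon>\<close>.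
\<close>

lemma regular_jumps_hold_down_gain:
  fixes lo hi up low x r \<epsilon> :: real
  assumes "0 \<le> lo" "lo \<le> hi" "0 \<le> up" "0 < \<epsilon>" "0 \<le> x"
    and r_eq: "r = (if low \<le> up then 0 else lo * (1 + (low - up) / \<epsilon>))"
  shows "up * (nat \<lfloor>r * x\<rfloor> - hi * x) + low * (lo * x - nat \<lfloor>r * x\<rfloor>) \<le> \<epsilon>"
proof -
  have "up * (lo * x) \<le> up * (hi * x)"
    using assms by (intro mult_left_mono mult_right_mono) auto
  then have "up * (nat \<lfloor>r * x\<rfloor> - hi * x) + low * (lo * x - nat \<lfloor>r * x\<rfloor>)
      \<le> (low - up) * (lo * x - nat \<lfloor>r * x\<rfloor>)"
    by (simp add: algebra_simps)
  also have "\<dots> \<le> \<epsilon>"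
  proof (cases "low \<le> up")
    case True
    then have "(low - up) * (lo * x) \<le> 0"
      using assms by (intro mult_nonpos_nonneg) auto
    then show ?thesis
      using True assms by simp
  next
    case False
    define d where "d = low - up"
    have d: "d > 0" and r: "r = lo * (1 + d / \<epsilon>)"
      using False by (auto simp: d_def r_eq)
    have "d * (lo * x - nat \<lfloor>r * x\<rfloor>) \<le> \<epsilon>"
    proof (cases "r * x < 1")
      case True
      have "d * (lo * x) \<le> \<epsilon> * (r * x)"
        using \<open>0 \<le> lo\<close> \<open>0 \<le> x\<close> \<open>0 < \<epsilon>\<close> by (simp add: r algebra_simps)
      also have "\<dots> \<le> \<epsilon>"
        using True \<open>0 < \<epsilon>\<close> by simp
      finally have "d * (lo * x) \<le> \<epsilon>" .
      moreover have "0 \<le> d * real (nat \<lfloor>r * x\<rfloor>)"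
        using d by simp
      ultimately show ?thesis
        by (simp add: right_diff_distrib)
    next
      case False
      have "real (nat \<lfloor>r * x\<rfloor>) \<ge> r * x - 1"
        using False by linarith
      then have "d * (lo * x - nat \<lfloor>r * x\<rfloor>) \<le> d * (lo * x - (r * x - 1))"
        using d by (intro mult_left_mono) auto
      also have "\<dots> = d * (1 - lo * d * x / \<epsilon>)"
        by (simp add: r algebra_simps)
      also have "\<dots> \<le> \<epsilon>"
      proof -
        define y where "y = lo * x"
        have "y * (\<epsilon> + d) \<ge> \<epsilon>"
          using False \<open>0 < \<epsilon>\<close> by (simp add: r y_def field_simps)
        then have "y \<ge> \<epsilon> / (\<epsilon> + d)"
          using d \<open>0 < \<epsilon>\<close> by (simp add: field_simps)
        then have "d / \<epsilon> * y \<ge> d / \<epsilon> * (\<epsilon> / (\<epsilon> + d))"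
          using d \<open>0 < \<epsilon>\<close> by (intro mult_left_mono) auto
        then have "1 - lo * d * x / \<epsilon> \<le> 1 - d / (\<epsilon> + d)"
          using \<open>0 < \<epsilon>\<close> by (simp add: y_def mult_ac)
        also have "\<dots> = \<epsilon> / (\<epsilon> + d)"
          using d \<open>0 < \<epsilon>\<close> by (simp add: field_simps)
        finally have "d * (1 - lo * d * x / \<epsilon>) \<le> d * (\<epsilon> / (\<epsilon> + d))"
          using d by (intro mult_left_mono) auto
        also have "\<dots> \<le> \<epsilon>"
          using d \<open>0 < \<epsilon>\<close> by (simp add: field_simps)
        finally show ?thesis .
      qed
      finally show ?thesis .
    qed
    then show ?thesis by (simp add: d_def)
  qed
  finally show ?thesis .
qed

text \<open>
  The stakes of a round are known when it starts, so from then on (or from \<open>t0\<close>, if the round is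
  already running at that time) the path can be chosen against these stakes. The path remains the
  same up to the start of the round, so the earlier rounds are not affected.
\<close>

lemma hold_down_one_round:
  assumes G: "elementary_strategy G" and k: "k \<in> {1..rounds G}"
    and lo: "0 \<le> lo" "lo \<le> hi" and "0 \<le> t0" "0 < \<epsilon>"
  obtains \<omega>' where "agree_upto (max (times G k \<omega>) (ereal t0)) \<omega> \<omega>'"
    "\<And>t. t0 \<le> t \<Longrightarrow> round_gain lo hi G k t \<omega>' \<le> round_gain lo hi G k t0 \<omega>' + \<epsilon>"
proof (cases "times G k \<omega> = \<infinity>")
  case True
  then have "times G (k + 1) \<omega> = \<infinity>"
    using elementary_strategyD(3)[OF G k, of \<omega>] by simp
  with True have "round_gain lo hi G k t \<omega> = 0" for t
    by (simp add: round_gain_def stopped_eq)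
  then show ?thesis
    using that[of \<omega>] \<open>0 < \<epsilon>\<close> by (simp add: agree_upto_def)
next
  case False
  note D = elementary_strategyD[OF G k]
  from False obtain \<alpha> where \<alpha>: "times G k \<omega> = ereal \<alpha>" "0 \<le> \<alpha>"
    using stopping_time_nonneg[OF D(1), of \<omega>] by (cases "times G k \<omega>") auto
  define a where "a = max \<alpha> t0"
  define up low where "up = the (upper_stake G k \<omega>)" and "low = the (lower_stake G k \<omega>)"
  have "0 \<le> up" "0 \<le> low"
    using \<alpha> D(4,5) stake_nonneg unfolding up_def low_def by fastforce+
  define r where "r = (if low \<le> up then 0 else lo * (1 + (low - up) / \<epsilon>))"
  have "0 \<le> r" "0 \<le> a"
    using lo \<open>0 < \<epsilon>\<close> \<open>0 \<le> t0\<close> by (auto simp: r_def a_def)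
  define \<omega>' where "\<omega>' = continue_at_rate a r \<omega>"
  have agree: "agree_upto (ereal a) \<omega> \<omega>'"
    unfolding \<omega>'_def using \<open>0 \<le> a\<close> \<open>0 \<le> r\<close> by (rule agree_upto_continue_at_rate)
  then have agree_k: "agree_upto (times G k \<omega>) \<omega> \<omega>'"
    by (rule agree_upto_mono) (simp add: \<alpha> a_def)
  have \<alpha>': "times G k \<omega>' = ereal \<alpha>"
    using stopping_time_agree[OF D(1) agree_k] \<alpha> by simp
  have stakes: "the (upper_stake G k \<omega>') = up" "the (lower_stake G k \<omega>') = low"
    using stake_cong[OF D(4) agree_k D(1)] stake_cong[OF D(5) agree_k D(1)] \<alpha>
    by (auto simp: up_def low_def)
  show ?thesis
  proof (rule that[of \<omega>'])
    show "agree_upto (max (times G k \<omega>) (ereal t0)) \<omega> \<omega>'"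
      using agree by (simp add: \<alpha> a_def)
    fix t assume "t0 \<le> t"
    define b where "b = times G (k + 1) \<omega>'"
    have "ereal \<alpha> \<le> b"
      using D(3)[of \<omega>'] \<alpha>' by (simp add: b_def)
    define B where "B = (\<lambda>t. if b \<le> ereal t then real_of_ereal b else t)"
    have gain: "round_gain lo hi G k s \<omega>' =
        up * (real (N (B s) \<omega>') - real (N (min \<alpha> s) \<omega>') - hi * (B s - min \<alpha> s))
        + low * (lo * (B s - min \<alpha> s) - real (N (B s) \<omega>') + real (N (min \<alpha> s) \<omega>'))" for s
      by (simp add: round_gain_eq stakes stopped_eq \<alpha>' Let_def B_def b_def min_def)
    (* In the first two cases the round has not started by t or has ended by t0, so nothing is
       gained in between. In the last case the gain is that of the stretch from a to B t. *)
    consider "t \<le> \<alpha>" | "b \<le> ereal t0" | "t > \<alpha>" "b > ereal t0"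
      by fastforce
    then show "round_gain lo hi G k t \<omega>' \<le> round_gain lo hi G k t0 \<omega>' + \<epsilon>"
    proof cases
      case 1
      have "B s = s" if "s \<le> \<alpha>" for s
        using that \<open>ereal \<alpha> \<le> b\<close> by (cases b) (auto simp: B_def)
      then show ?thesis
        using 1 \<open>t0 \<le> t\<close> \<open>0 < \<epsilon>\<close> by (simp add: gain)
    next
      case 2
      then have "B t = B t0" "min \<alpha> t = min \<alpha> t0"
        using \<open>t0 \<le> t\<close> \<open>ereal \<alpha> \<le> b\<close> by (cases b; auto simp: B_def)+
      then show ?thesis
        using \<open>0 < \<epsilon>\<close> by (simp add: gain)
    next
      case 3
      have B: "B t0 = t0" "a \<le> B t"
        using 3 \<open>t0 \<le> t\<close> \<open>ereal \<alpha> \<le> b\<close> by (cases b; auto simp: B_def a_def)+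
      have "round_gain lo hi G k t \<omega>' - round_gain lo hi G k t0 \<omega>' =
          up * (real (N (B t) \<omega>') - real (N a \<omega>') - hi * (B t - a))
        + low * (lo * (B t - a) - real (N (B t) \<omega>') + real (N a \<omega>'))"
        using 3 B by (cases "t0 \<le> \<alpha>") (auto simp: gain a_def algebra_simps)
      also have "\<dots> = up * (nat \<lfloor>r * (B t - a)\<rfloor> - hi * (B t - a))
          + low * (lo * (B t - a) - nat \<lfloor>r * (B t - a)\<rfloor>)"
        using B \<open>0 \<le> r\<close> \<open>0 \<le> a\<close>
        by (cases "B t = a") (simp_all add: \<omega>'_def N_continue_at_rate algebra_simps)
      also have "\<dots> \<le> \<epsilon>"
        by (rule regular_jumps_hold_down_gain[OF lo \<open>0 \<le> up\<close> \<open>0 < \<epsilon>\<close> _ r_def]) (use B in simp)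
      finally show ?thesis by simp
    qed
  qed
qed

lemma capital_cong:
  assumes "elementary_strategy G" "0 \<le> t" "agree_upto (ereal t) \<omega>1 \<omega>2"
  shows "capital lo hi G c t \<omega>1 = capital lo hi G c t \<omega>2"
  unfolding capital_def
  using assms by (auto intro!: sum.cong round_gain_cong elim: agree_upto_mono)

text \<open>
  Coherence: the rounds are held down one after the other, each at the cost of an equal
  share of \<open>\<epsilon>\<close>.
\<close>

lemma no_arbitrage:
  assumes G: "elementary_strategy G"
    and lo: "0 \<le> lo" "lo \<le> hi" and "0 \<le> t0" "0 < \<epsilon>"
  obtains \<omega>' where "agree_upto (ereal t0) \<omega> \<omega>'"
    "\<And>t. t0 \<le> t \<Longrightarrow> capital lo hi G c t \<omega>' \<le> capital lo hi G c t0 \<omega> + \<epsilon>"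
proof -
  define \<delta> where "\<delta> = \<epsilon> / rounds G"
  have "rounds G \<ge> 1"
    using G by (simp add: elementary_strategy_def)
  then have "\<delta> > 0"
    using \<open>0 < \<epsilon>\<close> by (simp add: \<delta>_def)
  have "\<exists>\<omega>'. agree_upto (ereal t0) \<omega> \<omega>' \<and>
      (\<forall>t\<ge>t0. (\<Sum>k = 1..m. round_gain lo hi G k t \<omega>')
         \<le> (\<Sum>k = 1..m. round_gain lo hi G k t0 \<omega>') + m * \<delta>)" if "m \<le> rounds G" for m
    using that
  proof (induction m)
    case 0
    then show ?case
      by (auto intro: exI[of _ \<omega>] simp: agree_upto_def)
  next
    case (Suc m)
    then obtain \<omega>' where \<omega>': "agree_upto (ereal t0) \<omega> \<omega>'"
      "\<And>t. t0 \<le> t \<Longrightarrow> (\<Sum>k = 1..m. round_gain lo hi G k t \<omega>')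
         \<le> (\<Sum>k = 1..m. round_gain lo hi G k t0 \<omega>') + m * \<delta>"
      by auto
    have m: "Suc m \<in> {1..rounds G}"
      using Suc.prems by simp
    obtain \<omega>'' where agree: "agree_upto (max (times G (Suc m) \<omega>') (ereal t0)) \<omega>' \<omega>''"
      and last: "\<And>t. t0 \<le> t \<Longrightarrow>
        round_gain lo hi G (Suc m) t \<omega>'' \<le> round_gain lo hi G (Suc m) t0 \<omega>'' + \<delta>"
      using hold_down_one_round[OF G m lo \<open>0 \<le> t0\<close> \<open>0 < \<delta>\<close>] by blast
    have times_le: "times G (k + 1) \<omega>' \<le> times G (Suc m) \<omega>'" if "k \<in> {1..m}" for k
    proof -
      have "k + 1 \<le> Suc m" using that by simp
      then show ?thesis
        using that Suc.prems
      proof (induction rule: inc_induct)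
        case (step n)
        then show ?case
          using elementary_strategyD(3)[OF G, of n \<omega>'] by force
      qed simp
    qed
    have same: "round_gain lo hi G k t \<omega>'' = round_gain lo hi G k t \<omega>'"
      if "k \<in> {1..m}" "t0 \<le> t" for k t
      using that Suc.prems \<open>0 \<le> t0\<close> times_le[of k]
      by (intro round_gain_cong[symmetric] G agree_upto_mono[OF agree])
        (auto simp: min_le_iff_disj le_max_iff_disj)
    have "(\<Sum>k = 1..Suc m. round_gain lo hi G k t \<omega>'')
        \<le> (\<Sum>k = 1..Suc m. round_gain lo hi G k t0 \<omega>'') + Suc m * \<delta>" if "t0 \<le> t" for t
      using \<omega>'(2)[OF that] last[OF that] that same by (simp add: algebra_simps)
    moreover have "agree_upto (ereal t0) \<omega> \<omega>''"
      by (rule agree_upto_trans[OF \<omega>'(1) agree_upto_mono[OF agree]]) simp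
    ultimately show ?case
      by blast
  qed
  from this[of "rounds G"] obtain \<omega>' where \<omega>': "agree_upto (ereal t0) \<omega> \<omega>'"
    and bound: "\<And>t. t0 \<le> t \<Longrightarrow> capital lo hi G c t \<omega>' \<le> capital lo hi G c t0 \<omega>' + \<epsilon>"
    using \<open>rounds G \<ge> 1\<close> by (auto simp: capital_def \<delta>_def add.assoc)
  show ?thesis
    using that[OF \<omega>'] bound capital_cong[OF G \<open>0 \<le> t0\<close> \<omega>'] by metis
qed

section \<open>Frozen paths and their one-jump perturbations\<close>

lemma N_frozen:
  assumes "0 \<le> s" "0 \<le> t"
  shows "N t (continue_at_rate s 0 \<omega>) = N (min s t) \<omega>"
  using assms by (auto simp: N_continue_at_rate min_def)

lemma N_one_jump_before:
  assumes "0 \<le> s" "s < u" "0 \<le> t" "t < u"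
  shows "N t (continue_at_rate s (1 / (u - s)) \<omega>) = N (min s t) \<omega>"
proof (cases "t \<le> s")
  case False
  then have "\<lfloor>1 / (u - s) * (t - s)\<rfloor> = 0"
    using assms by (intro floor_unique) (auto simp: field_simps)
  then show ?thesis
    using assms False by (simp add: N_continue_at_rate)
qed (use assms in \<open>simp add: N_continue_at_rate\<close>)

lemma N_one_jump_at:
  assumes "0 \<le> s" "s < u"
  shows "N u (continue_at_rate s (1 / (u - s)) \<omega>) = N s \<omega> + 1"
  using assms by (simp add: N_continue_at_rate)

text \<open>
  A round counts the jumps in \<open>(\<tau>\<^sub>k, \<tau>\<^sub>k\<^sub>+\<^sub>1]\<close>, which explains the strict and the nonstrict
  inequality below.
\<close>

definition net_stake :: "strategy \<Rightarrow> real \<Rightarrow> path \<Rightarrow> real" where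
  "net_stake G u \<omega> =
     (\<Sum>k = 1..rounds G. if times G k \<omega> < ereal u \<and> ereal u \<le> times G (k + 1) \<omega>
        then the (upper_stake G k \<omega>) - the (lower_stake G k \<omega>) else 0)"

text \<open>
  Up to the cut-off at \<open>u\<close> the two paths give the same times and stakes, by
  \<open>agree_before_imp_min_eq\<close>; only the number of jumps at time \<open>u\<close> itself differs.
\<close>

lemma round_gain_one_jump:
  assumes G: "elementary_strategy G" and k: "k \<in> {1..rounds G}" and "0 \<le> u"
    and before: "\<And>t. 0 \<le> t \<Longrightarrow> t < u \<Longrightarrow> N t \<omega>1 = N t \<omega>2"
    and jump: "N u \<omega>2 = N u \<omega>1 + 1"
  shows "round_gain lo hi G k u \<omega>2 = round_gain lo hi G k u \<omega>1 +
    (if times G k \<omega>1 < ereal u \<and> ereal u \<le> times G (k + 1) \<omega>1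
     then the (upper_stake G k \<omega>1) - the (lower_stake G k \<omega>1) else 0)"
proof -
  note D = elementary_strategyD[OF G k]
  define a b where "a = stopped (times G k) u \<omega>1" and "b = stopped (times G (k + 1)) u \<omega>1"
  have a: "stopped (times G k) u \<omega>2 = a" and b: "stopped (times G (k + 1)) u \<omega>2 = b"
    using agree_before_imp_min_eq[OF D(1) before] agree_before_imp_min_eq[OF D(2) before]
    by (simp_all add: a_def b_def stopped_def)
  have ab: "0 \<le> a" "0 \<le> b"
    using D(1,2) \<open>0 \<le> u\<close> by (auto simp: a_def b_def intro: stopped_nonneg)
  show ?thesis
  proof (cases "times G k \<omega>1 < ereal u")
    case False
    then have "ereal u \<le> times G k \<omega>1" "ereal u \<le> times G (k + 1) \<omega>1"
      using D(3)[of \<omega>1] by (auto intro: order_trans)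
    then have "a = u" "b = u"
      by (simp_all add: a_def b_def stopped_def min_absorb2)
    then show ?thesis
      unfolding round_gain_eq a b a_def[symmetric] b_def[symmetric]
      using False by (simp add: Let_def)
  next
    case True
    have "agree_upto (times G k \<omega>1) \<omega>1 \<omega>2"
      unfolding agree_upto_def using before True
      by (metis le_less_trans less_ereal.simps(1))
    then have stakes: "upper_stake G k \<omega>1 = upper_stake G k \<omega>2"
        "lower_stake G k \<omega>1 = lower_stake G k \<omega>2"
      using True by (auto intro!: stake_cong[OF D(4) _ D(1)] stake_cong[OF D(5) _ D(1)])
    have "ereal a < ereal u"
      unfolding a_def ereal_stopped[OF D(1)] using True by simp
    then have "N a \<omega>1 = N a \<omega>2"
      using before ab by simp
    moreover have "N b \<omega>2 = N b \<omega>1 + (if ereal u \<le> times G (k + 1) \<omega>1 then 1 else 0)"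
    proof (cases "ereal u \<le> times G (k + 1) \<omega>1")
      case True
      then have "b = u" by (simp add: b_def stopped_def min_def)
      with True jump show ?thesis by simp
    next
      case False
      then have "ereal b < ereal u"
        unfolding b_def ereal_stopped[OF D(2)] by simp
      with False before ab show ?thesis by simp
    qed
    ultimately show ?thesis
      unfolding round_gain_eq a b a_def[symmetric] b_def[symmetric]
      using True stakes by (simp add: Let_def algebra_simps)
  qed
qed

lemma capital_one_jump:
  assumes "elementary_strategy G" "0 \<le> s" "s < u"
  shows "capital lo hi G c u (continue_at_rate s (1 / (u - s)) \<omega>) =
    capital lo hi G c u (continue_at_rate s 0 \<omega>) + net_stake G u (continue_at_rate s 0 \<omega>)"
  unfolding capital_def net_stake_def add.assoc sum.distrib[symmetric]
  using assms
  by (intro arg_cong[of _ _ "(+) c"] sum.cong round_gain_one_jump)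
    (auto simp: N_frozen N_one_jump_before N_one_jump_at)

text \<open>
  Without jumps after \<open>s\<close>, the cut-off at \<open>t\<close> moves only the compensators, so that the capital
  is a piecewise linear function of \<open>t\<close>.
\<close>

lemma N_stopped_frozen:
  assumes "stopping_time \<tau>" "0 \<le> s" "s \<le> t"
  shows "N (stopped \<tau> t (continue_at_rate s 0 \<omega>)) (continue_at_rate s 0 \<omega>) =
    N (stopped \<tau> s (continue_at_rate s 0 \<omega>)) (continue_at_rate s 0 \<omega>)"
proof -
  let ?\<omega> = "continue_at_rate s 0 \<omega>"
  have "min s (stopped \<tau> t ?\<omega>) = min s (stopped \<tau> s ?\<omega>)"
    using assms(3) stopping_time_nonneg[OF assms(1), of ?\<omega>]
    by (cases "\<tau> ?\<omega>") (auto simp: stopped_eq min_def)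
  then show ?thesis
    using assms by (simp add: N_frozen stopped_nonneg)
qed

text \<open>The slope of the capital during round \<open>k\<close> while no jumps occur.\<close>

definition frozen_drift :: "real \<Rightarrow> real \<Rightarrow> strategy \<Rightarrow> nat \<Rightarrow> path \<Rightarrow> real" where
  "frozen_drift lo hi G k \<omega> =
     lo * the (lower_stake G k \<omega>) - hi * the (upper_stake G k \<omega>)"

lemma capital_frozen:
  assumes G: "elementary_strategy G" and "0 \<le> s"
  obtains C where "\<And>t. s \<le> t \<Longrightarrow> capital lo hi G c t (continue_at_rate s 0 \<omega>) =
    C + (\<Sum>k = 1..rounds G. frozen_drift lo hi G k (continue_at_rate s 0 \<omega>) *
      (stopped (times G (k + 1)) t (continue_at_rate s 0 \<omega>)
       - stopped (times G k) t (continue_at_rate s 0 \<omega>)))"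
proof -
  let ?\<omega> = "continue_at_rate s 0 \<omega>"
  define n where "n k = real (N (stopped (times G (k + 1)) s ?\<omega>) ?\<omega>)
    - real (N (stopped (times G k) s ?\<omega>) ?\<omega>)" for k
  define C where "C = c + (\<Sum>k = 1..rounds G.
    (the (upper_stake G k ?\<omega>) - the (lower_stake G k ?\<omega>)) * n k)"
  show ?thesis
  proof (rule that[of C])
    fix t assume "s \<le> t"
    have "round_gain lo hi G k t ?\<omega> =
        (the (upper_stake G k ?\<omega>) - the (lower_stake G k ?\<omega>)) * n k +
        frozen_drift lo hi G k ?\<omega> *
          (stopped (times G (k + 1)) t ?\<omega> - stopped (times G k) t ?\<omega>)"
      if "k \<in> {1..rounds G}" for k
    proof -
      note N_eq = N_stopped_frozen[OF elementary_strategyD(1)[OF G that] \<open>0 \<le> s\<close> \<open>s \<le> t\<close>]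
        N_stopped_frozen[OF elementary_strategyD(2)[OF G that] \<open>0 \<le> s\<close> \<open>s \<le> t\<close>]
      show ?thesis
        unfolding round_gain_eq Let_def N_eq n_def frozen_drift_def by (simp add: algebra_simps)
    qed
    then show "capital lo hi G c t ?\<omega> = C + (\<Sum>k = 1..rounds G. frozen_drift lo hi G k ?\<omega> *
      (stopped (times G (k + 1)) t ?\<omega> - stopped (times G k) t ?\<omega>))"
      by (simp add: capital_def C_def sum.distrib)
  qed
qed

lemma stopped_has_derivative:
  assumes "stopping_time \<tau>" "\<tau> \<omega> \<noteq> ereal u"
  shows "((\<lambda>t. stopped \<tau> t \<omega>) has_real_derivative (if ereal u < \<tau> \<omega> then 1 else 0)) (at u)"
proof (cases "ereal u < \<tau> \<omega>")
  case True
  have "eventually (\<lambda>t. ereal t < \<tau> \<omega>) (nhds u)"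
    using True by (intro order_tendstoD(2)[of _ "ereal u"]) (auto simp: filterlim_ident)
  then have "eventually (\<lambda>t. t = stopped \<tau> t \<omega>) (nhds u)"
    by (rule eventually_mono) (auto simp: stopped_eq)
  then show ?thesis
    using True by (auto intro: DERIV_cong_ev[THEN iffD1, OF refl _ refl DERIV_ident])
next
  case False
  then have "\<tau> \<omega> < ereal u"
    using assms by auto
  then have "eventually (\<lambda>t. \<tau> \<omega> < ereal t) (nhds u)"
    by (intro order_tendstoD(1)[of _ "ereal u"]) (auto simp: filterlim_ident)
  then have "eventually (\<lambda>t. real_of_ereal (\<tau> \<omega>) = stopped \<tau> t \<omega>) (nhds u)"
    by (rule eventually_mono) (auto simp: stopped_eq)
  then show ?thesis
    using False by (auto intro: DERIV_cong_ev[THEN iffD1, OF refl _ refl DERIV_const])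
qed

lemma continuous_on_stopped:
  assumes "stopping_time \<tau>"
  shows "continuous_on A (\<lambda>t. stopped \<tau> t \<omega>)"
proof (cases "\<tau> \<omega>")
  case (real r)
  then have "stopped \<tau> t \<omega> = min r t" for t
    by (simp add: stopped_eq min_def)
  then show ?thesis
    by (simp add: continuous_on_min)
next
  case PInf
  then show ?thesis by (simp add: stopped_eq)
next
  case MInf
  then show ?thesis using stopping_time_nonneg[OF assms, of \<omega>] by simp
qed

lemma capital_frozen_has_derivative:
  assumes G: "elementary_strategy G" and "0 \<le> s" "s < u"
    and no_stop: "\<And>k. k \<in> {1..rounds G + 1} \<Longrightarrow> times G k (continue_at_rate s 0 \<omega>) \<noteq> ereal u"
  shows "((\<lambda>t. capital lo hi G c t (continue_at_rate s 0 \<omega>)) has_real_derivative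
    (\<Sum>k = 1..rounds G. if times G k (continue_at_rate s 0 \<omega>) < ereal u \<and>
        ereal u \<le> times G (k + 1) (continue_at_rate s 0 \<omega>)
      then frozen_drift lo hi G k (continue_at_rate s 0 \<omega>) else 0)) (at u)"
proof -
  let ?\<omega> = "continue_at_rate s 0 \<omega>"
  obtain C where C: "\<And>t. s \<le> t \<Longrightarrow> capital lo hi G c t ?\<omega> =
    C + (\<Sum>k = 1..rounds G. frozen_drift lo hi G k ?\<omega> *
      (stopped (times G (k + 1)) t ?\<omega> - stopped (times G k) t ?\<omega>))" (is "\<And>t. _ \<Longrightarrow> _ = ?g t")
    using capital_frozen[OF G \<open>0 \<le> s\<close>] by blast
  have drv: "((\<lambda>t. frozen_drift lo hi G k ?\<omega> *
      (stopped (times G (k + 1)) t ?\<omega> - stopped (times G k) t ?\<omega>)) has_real_derivative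
      (if times G k ?\<omega> < ereal u \<and> ereal u \<le> times G (k + 1) ?\<omega>
       then frozen_drift lo hi G k ?\<omega> else 0)) (at u)"
    if k: "k \<in> {1..rounds G}" for k
  proof -
    note D = elementary_strategyD[OF G k]
    have ne: "times G k ?\<omega> \<noteq> ereal u" "times G (k + 1) ?\<omega> \<noteq> ereal u"
      using k by (auto intro!: no_stop)
    have "((\<lambda>t. frozen_drift lo hi G k ?\<omega> *
      (stopped (times G (k + 1)) t ?\<omega> - stopped (times G k) t ?\<omega>)) has_real_derivative
      frozen_drift lo hi G k ?\<omega> * ((if ereal u < times G (k + 1) ?\<omega> then 1 else 0) -
        (if ereal u < times G k ?\<omega> then 1 else 0))) (at u)"
      by (intro DERIV_cmult DERIV_diff stopped_has_derivative D ne)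
    moreover have "frozen_drift lo hi G k ?\<omega> * ((if ereal u < times G (k + 1) ?\<omega> then 1 else 0) -
        (if ereal u < times G k ?\<omega> then 1 else 0)) =
       (if times G k ?\<omega> < ereal u \<and> ereal u \<le> times G (k + 1) ?\<omega>
       then frozen_drift lo hi G k ?\<omega> else 0)"
      using ne D(3)[of ?\<omega>] by auto
    ultimately show ?thesis by simp
  qed
  have "(?g has_real_derivative
    0 + (\<Sum>k = 1..rounds G. if times G k ?\<omega> < ereal u \<and> ereal u \<le> times G (k + 1) ?\<omega>
      then frozen_drift lo hi G k ?\<omega> else 0)) (at u)"
    by (intro DERIV_add DERIV_const DERIV_sum drv)
  moreover have "eventually (\<lambda>t. ?g t = capital lo hi G c t ?\<omega>) (nhds u)"
    using eventually_nhds_in_open[of "{s<..}" u] \<open>s < u\<close> C by (auto elim!: eventually_mono)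
  ultimately show ?thesis
    using DERIV_cong_ev[OF refl _ refl] by fastforce
qed

lemma continuous_on_capital_frozen:
  assumes G: "elementary_strategy G" and "0 \<le> s"
  shows "continuous_on {s..} (\<lambda>t. capital lo hi G c t (continue_at_rate s 0 \<omega>))"
proof -
  let ?\<omega> = "continue_at_rate s 0 \<omega>"
  obtain C where C: "\<And>t. s \<le> t \<Longrightarrow> capital lo hi G c t ?\<omega> =
    C + (\<Sum>k = 1..rounds G. frozen_drift lo hi G k ?\<omega> *
      (stopped (times G (k + 1)) t ?\<omega> - stopped (times G k) t ?\<omega>))" (is "\<And>t. _ \<Longrightarrow> _ = ?g t")
    using capital_frozen[OF G \<open>0 \<le> s\<close>] by blast
  have "continuous_on {s..} ?g"
    by (intro continuous_intros continuous_on_stopped) (use elementary_strategyD[OF G] in auto)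
  then show ?thesis
    by (rule continuous_on_cong[THEN iffD1, rotated -1]) (simp_all add: C)
qed

text \<open>
  This is the supermartingale property of the capital under the Poisson process of rate \<open>\<mu>\<close>, seen
  before the first jump: the drift plus \<open>\<mu>\<close> times the size of a possible jump is at most \<open>0\<close>.
\<close>

lemma drift_le_net_stake:
  assumes G: "elementary_strategy G" and "0 \<le> lo" "lo \<le> \<mu>" "\<mu> \<le> hi"
  shows "(\<Sum>k = 1..rounds G. if times G k \<omega> < ereal u \<and> ereal u \<le> times G (k + 1) \<omega>
      then frozen_drift lo hi G k \<omega> else 0) \<le> - \<mu> * net_stake G u \<omega>"
  unfolding net_stake_def sum_distrib_left
proof (rule sum_mono)
  fix k assume k: "k \<in> {1..rounds G}"
  note D = elementary_strategyD[OF G k]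
  have "frozen_drift lo hi G k \<omega> \<le> - \<mu> * (the (upper_stake G k \<omega>) - the (lower_stake G k \<omega>))"
    if "times G k \<omega> < ereal u"
  proof -
    have "times G k \<omega> < \<infinity>"
      using that by auto
    then have "lo * the (lower_stake G k \<omega>) \<le> \<mu> * the (lower_stake G k \<omega>)"
        "\<mu> * the (upper_stake G k \<omega>) \<le> hi * the (upper_stake G k \<omega>)"
      using assms D(4,5) stake_nonneg by (blast intro: mult_right_mono)+
    then show ?thesis
      by (simp add: frozen_drift_def algebra_simps)
  qed
  then show "(if times G k \<omega> < ereal u \<and> ereal u \<le> times G (k + 1) \<omega>
      then frozen_drift lo hi G k \<omega> else 0) \<le> - \<mu> *
     (if times G k \<omega> < ereal u \<and> ereal u \<le> times G (k + 1) \<omega>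
        then the (upper_stake G k \<omega>) - the (lower_stake G k \<omega>) else 0)"
    by auto
qed

lemma antitone_of_deriv_nonpos_off_finite:
  fixes f f' :: "real \<Rightarrow> real"
  assumes "finite S" "a \<le> b" "continuous_on {a..b} f"
    and deriv: "\<And>x. a < x \<Longrightarrow> x < b \<Longrightarrow> x \<notin> S \<Longrightarrow> (f has_real_derivative f' x) (at x)"
    and nonpos: "\<And>x. a < x \<Longrightarrow> x < b \<Longrightarrow> x \<notin> S \<Longrightarrow> f' x \<le> 0"
  shows "f b \<le> f a"
proof -
  define f'' where "f'' x = (if x \<in> {a<..<b} - S then f' x else 0)" for x
  have "(f'' has_integral (f b - f a)) {a..b}"
    using assms
    by (intro fundamental_theorem_of_calculus_interior_strong[of S])
      (auto simp: f''_def has_real_derivative_iff_has_vector_derivative)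
  then have "f b - f a \<le> 0"
    by (rule has_integral_le[OF _ has_integral_0]) (use nonpos in \<open>auto simp: f''_def\<close>)
  then show ?thesis by simp
qed

lemma finite_stop_times: "finite {u. \<exists>k\<in>{1..rounds G + 1}. times G k \<omega> = ereal u}"
  by (rule finite_subset[of _ "(\<lambda>k. real_of_ereal (times G k \<omega>)) ` {1..rounds G + 1}"])
    (force simp: image_iff)+

lemma capital_frozen_antitone:
  assumes G: "elementary_strategy G" and "0 \<le> s" "s \<le> t" "0 \<le> hi"
  shows "capital 0 hi G c t (continue_at_rate s 0 \<omega>) \<le> capital 0 hi G c s (continue_at_rate s 0 \<omega>)"
proof -
  let ?\<omega> = "continue_at_rate s 0 \<omega>"
  show ?thesis
  proof (rule antitone_of_deriv_nonpos_off_finite[OF finite_stop_times[of G ?\<omega>] \<open>s \<le> t\<close>])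
    show "continuous_on {s..t} (\<lambda>t. capital 0 hi G c t ?\<omega>)"
      by (rule continuous_on_subset[OF continuous_on_capital_frozen[OF G \<open>0 \<le> s\<close>]]) auto
  next
    fix u assume u: "s < u" "u \<notin> {u. \<exists>k\<in>{1..rounds G + 1}. times G k ?\<omega> = ereal u}"
    then show "((\<lambda>t. capital 0 hi G c t ?\<omega>) has_real_derivative
      (\<Sum>k = 1..rounds G. if times G k ?\<omega> < ereal u \<and> ereal u \<le> times G (k + 1) ?\<omega>
        then frozen_drift 0 hi G k ?\<omega> else 0)) (at u)"
      by (intro capital_frozen_has_derivative G \<open>0 \<le> s\<close>) auto
    show "(\<Sum>k = 1..rounds G. if times G k ?\<omega> < ereal u \<and> ereal u \<le> times G (k + 1) ?\<omega>
        then frozen_drift 0 hi G k ?\<omega> else 0) \<le> 0"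
      using drift_le_net_stake[OF G order_refl order_refl \<open>0 \<le> hi\<close>, of ?\<omega> u] by simp
  qed
qed

text \<open>
  The function \<open>t \<mapsto> \<sigma> * (t - s) + \<sigma> / \<mu>\<close> is the expectation of \<open>\<sigma> * (\<rho> - s)\<close> under the rate \<open>\<mu>\<close>,
  given that there was no jump up to \<open>t\<close>. The excess \<open>\<phi>\<close> of the capital over it satisfies
  \<open>\<phi>' \<le> \<mu> * \<phi>\<close>, so \<open>exp (- \<mu> * t) * \<phi> t\<close> is nonincreasing. Since \<open>\<phi>\<close> is at least
  a linear function, a negative value at \<open>s\<close> is impossible.
\<close>

lemma capital_ge_of_jump_bound:
  assumes G: "elementary_strategy G" and lo: "0 \<le> lo" "lo \<le> \<mu>" "\<mu> \<le> hi" and "0 < \<mu>"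
    and "0 \<le> s"
    and below: "\<And>t \<omega>. 0 \<le> t \<Longrightarrow> C \<le> capital lo hi G c t \<omega>"
    and jump: "\<And>u. s < u \<Longrightarrow>
      \<sigma> * (u - s) \<le> capital lo hi G c u (continue_at_rate s (1 / (u - s)) \<omega>)"
  shows "\<sigma> / \<mu> \<le> capital lo hi G c s \<omega>"
proof -
  let ?\<omega> = "continue_at_rate s 0 \<omega>"
  define g where "g t = capital lo hi G c t ?\<omega>" for t
  define \<phi> where "\<phi> t = g t - \<sigma> * (t - s) - \<sigma> / \<mu>" for t
  define \<psi> where "\<psi> t = exp (- \<mu> * (t - s)) * \<phi> t" for t
  define D where "D u = (\<Sum>k = 1..rounds G.
    if times G k ?\<omega> < ereal u \<and> ereal u \<le> times G (k + 1) ?\<omega>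
    then frozen_drift lo hi G k ?\<omega> else 0)" for u
  have antitone: "\<psi> t \<le> \<psi> s" if "s \<le> t" for t
  proof (rule antitone_of_deriv_nonpos_off_finite[OF finite_stop_times[of G ?\<omega>] that])
    have "continuous_on {s..t} g"
      unfolding g_def
      by (rule continuous_on_subset[OF continuous_on_capital_frozen[OF G \<open>0 \<le> s\<close>]]) auto
    then show "continuous_on {s..t} \<psi>"
      unfolding \<psi>_def \<phi>_def by (intro continuous_intros)
  next
    fix u assume u: "s < u" "u \<notin> {u. \<exists>k\<in>{1..rounds G + 1}. times G k ?\<omega> = ereal u}"
    then have "(g has_real_derivative D u) (at u)"
      unfolding g_def D_def by (intro capital_frozen_has_derivative G \<open>0 \<le> s\<close>) auto
    then show "(\<psi> has_real_derivative exp (- \<mu> * (u - s)) * (D u - \<sigma> - \<mu> * \<phi> u)) (at u)"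
      unfolding \<psi>_def \<phi>_def by (auto intro!: derivative_eq_intros simp: algebra_simps)
    have "\<sigma> * (u - s) \<le> g u + net_stake G u ?\<omega>"
      using jump[OF u(1)] capital_one_jump[OF G \<open>0 \<le> s\<close> u(1)] by (simp add: g_def)
    then have "\<mu> * (\<sigma> * (u - s) - g u) \<le> \<mu> * net_stake G u ?\<omega>"
      using \<open>0 < \<mu>\<close> by simp
    moreover have "D u \<le> - \<mu> * net_stake G u ?\<omega>"
      unfolding D_def by (rule drift_le_net_stake[OF G lo])
    moreover have "\<mu> * \<phi> u = - (\<mu> * (\<sigma> * (u - s) - g u)) - \<sigma>"
      using \<open>0 < \<mu>\<close> by (simp add: \<phi>_def algebra_simps)
    ultimately have "D u - \<sigma> - \<mu> * \<phi> u \<le> 0"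
      by simp
    then show "exp (- \<mu> * (u - s)) * (D u - \<sigma> - \<mu> * \<phi> u) \<le> 0"
      by (intro mult_nonneg_nonpos) auto
  qed
  have "((\<lambda>t. exp (- \<mu> * (t - s)) * (C - \<sigma> * (t - s) - \<sigma> / \<mu>)) \<longlongrightarrow> 0) at_top"
    using \<open>0 < \<mu>\<close> by real_asymp
  moreover have "eventually (\<lambda>t. exp (- \<mu> * (t - s)) * (C - \<sigma> * (t - s) - \<sigma> / \<mu>) \<le> \<psi> s) at_top"
    using eventually_ge_at_top[of s]
  proof (rule eventually_mono)
    fix t assume "s \<le> t"
    have "exp (- \<mu> * (t - s)) * (C - \<sigma> * (t - s) - \<sigma> / \<mu>) \<le> \<psi> t"
      unfolding \<psi>_def \<phi>_def g_def using below[of t ?\<omega>] \<open>0 \<le> s\<close> \<open>s \<le> t\<close>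
      by (intro mult_left_mono) auto
    with antitone[OF \<open>s \<le> t\<close>] show "exp (- \<mu> * (t - s)) * (C - \<sigma> * (t - s) - \<sigma> / \<mu>) \<le> \<psi> s"
      by linarith
  qed
  ultimately have "0 \<le> \<psi> s"
    by (intro tendsto_upperbound[of _ 0 at_top]) auto
  moreover have "g s = capital lo hi G c s \<omega>"
    unfolding g_def
    by (rule capital_cong[OF G \<open>0 \<le> s\<close>, symmetric])
      (simp add: agree_upto_continue_at_rate \<open>0 \<le> s\<close>)
  ultimately show ?thesis
    by (simp add: \<psi>_def \<phi>_def)
qed

section \<open>The first jump after a given time\<close>

definition first_jump_after :: "real \<Rightarrow> path \<Rightarrow> ereal" where
  "first_jump_after s \<omega> = Inf {ereal r | r. s < r \<and> N s \<omega> < N r \<omega>}"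

lemma le_first_jump_after: "ereal s \<le> first_jump_after s \<omega>"
  by (auto simp: first_jump_after_def intro!: Inf_greatest)

lemma first_jump_after_le: "s < r \<Longrightarrow> N s \<omega> < N r \<omega> \<Longrightarrow> first_jump_after s \<omega> \<le> ereal r"
  by (auto simp: first_jump_after_def intro!: Inf_lower)

lemma le_first_jump_afterI:
  assumes "\<And>r. s < r \<Longrightarrow> N s \<omega> < N r \<omega> \<Longrightarrow> x \<le> ereal r"
  shows "x \<le> first_jump_after s \<omega>"
  unfolding first_jump_after_def using assms by (intro Inf_greatest) blast

lemma N_before_first_jump:
  assumes "0 \<le> s" "s \<le> r" "ereal r < first_jump_after s \<omega>"
  shows "N r \<omega> = N s \<omega>"
  using N_mono[OF assms(1,2), of \<omega>] first_jump_after_le[of s r \<omega>] assms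
  by (cases "s = r") (auto simp: not_le[symmetric])

text \<open>
  Right continuity makes the infimum a minimum, and the jumps of size one leave exactly one new
  count at that time.
\<close>

lemma N_at_first_jump:
  assumes "0 \<le> s" "first_jump_after s \<omega> = ereal p"
  shows "s < p" "N p \<omega> = N s \<omega> + 1"
proof -
  have still: "N r \<omega> = N s \<omega>" if "s \<le> r" "r < p" for r
    using N_before_first_jump[of s r \<omega>] assms that by simp
  have later: "ereal b \<le> first_jump_after s \<omega>"
    if "\<And>r. s < r \<Longrightarrow> r < b \<Longrightarrow> N r \<omega> \<le> N s \<omega>" for b
    by (rule le_first_jump_afterI) (use that in \<open>force simp flip: not_less\<close>)
  have "s \<le> p"
    using le_first_jump_after[of s \<omega>] assms by simp
  obtain b where b: "b > p" "\<And>u. p < u \<Longrightarrow> u < b \<Longrightarrow> N u \<omega> = N p \<omega>"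
    using N_locally_constant_right[of p \<omega>] \<open>0 \<le> s\<close> \<open>s \<le> p\<close> by auto
  have "N s \<omega> < N p \<omega>"
  proof (rule ccontr)
    assume "\<not> N s \<omega> < N p \<omega>"
    then have "N r \<omega> \<le> N s \<omega>" if "s < r" "r < b" for r
      using still[of r] b(2)[of r] that by (cases r p rule: linorder_cases) auto
    then have "ereal b \<le> ereal p"
      using later assms(2) by metis
    with b show False by simp
  qed
  then show "s < p"
    using \<open>s \<le> p\<close> by (cases "s = p") auto
  then have "0 < p"
    using \<open>0 \<le> s\<close> by simp
  obtain l d where ld: "d < p" "\<And>u. d < u \<Longrightarrow> u < p \<Longrightarrow> N u \<omega> = l"
      "N p \<omega> = l \<or> N p \<omega> = l + 1"
    using N_locally_constant_left[OF \<open>0 < p\<close>] by blast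
  obtain u where "max s d < u" "u < p"
    using dense[of "max s d" p] \<open>s < p\<close> \<open>d < p\<close> by auto
  then have "l = N s \<omega>"
    using still[of u] ld(2)[of u] by simp
  then show "N p \<omega> = N s \<omega> + 1"
    using ld(3) \<open>N s \<omega> < N p \<omega>\<close> by auto
qed

lemma first_jump_after_eqI:
  assumes "s < u" "N s \<omega> < N u \<omega>" "\<And>r. s < r \<Longrightarrow> r < u \<Longrightarrow> N r \<omega> = N s \<omega>"
  shows "first_jump_after s \<omega> = ereal u"
proof (rule antisym)
  show "ereal u \<le> first_jump_after s \<omega>"
  proof (rule le_first_jump_afterI)
    fix r assume "s < r" "N s \<omega> < N r \<omega>"
    then show "ereal u \<le> ereal r"
      using assms(3)[of r] by (cases "r < u") auto
  qed
qed (use assms first_jump_after_le in auto)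

lemma first_jump_after_frozen:
  assumes "0 \<le> s"
  shows "first_jump_after s (continue_at_rate s 0 \<omega>) = \<infinity>"
proof -
  have "\<infinity> \<le> first_jump_after s (continue_at_rate s 0 \<omega>)"
    by (rule le_first_jump_afterI) (use assms in \<open>simp add: N_frozen\<close>)
  then show ?thesis by simp
qed

lemma waiting_time_eq:
  assumes "\<tau> \<omega> = ereal s"
  shows "waiting_time \<tau> \<omega> = Some (first_jump_after s \<omega> - ereal s)"
  using assms by (simp add: waiting_time_def next_jump_def finite_event_def first_jump_after_def)

section \<open>Betting until the first jump or a deadline\<close>

definition jump_or_deadline :: "(path \<Rightarrow> ereal) \<Rightarrow> ereal \<Rightarrow> path \<Rightarrow> ereal" where
  "jump_or_deadline \<tau> T \<omega> =
     (if \<tau> \<omega> = \<infinity> then \<infinity>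
      else min (first_jump_after (real_of_ereal (\<tau> \<omega>)) \<omega>) (\<tau> \<omega> + T))"

lemma le_jump_or_deadline:
  assumes "stopping_time \<tau>" "0 \<le> T"
  shows "\<tau> \<omega> \<le> jump_or_deadline \<tau> T \<omega>"
  using stopping_time_nonneg[OF assms(1), of \<omega>] assms(2) le_first_jump_after[of "real_of_ereal (\<tau> \<omega>)" \<omega>]
  by (cases "\<tau> \<omega>"; cases T) (auto simp: jump_or_deadline_def)

text \<open>
  The infimum that defines a first jump is attained, so a path that is known up to and including
  the minimum of jump and deadline already shows which of the two it is.
\<close>

lemma stopping_time_jump_or_deadline:
  assumes \<tau>: "stopping_time \<tau>" and T: "0 \<le> T"
  shows "stopping_time (jump_or_deadline \<tau> T)"
  unfolding stopping_time_def
proof (intro conjI allI impI)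
  show "0 \<le> jump_or_deadline \<tau> T \<omega>" for \<omega>
    using stopping_time_nonneg[OF \<tau>] le_jump_or_deadline[OF \<tau> T] order_trans by blast
next
  fix \<omega>1 \<omega>2
  assume agree: "agree_upto (jump_or_deadline \<tau> T \<omega>1) \<omega>1 \<omega>2"
  have \<tau>12: "\<tau> \<omega>2 = \<tau> \<omega>1"
    by (rule stopping_time_agree[OF \<tau> agree_upto_mono[OF agree le_jump_or_deadline[OF \<tau> T]]])
  show "jump_or_deadline \<tau> T \<omega>1 = jump_or_deadline \<tau> T \<omega>2"
  proof (cases "\<tau> \<omega>1")
    case (real s)
    then have "0 \<le> s"
      using stopping_time_nonneg[OF \<tau>, of \<omega>1] by simp
    define d where "d = \<tau> \<omega>1 + T"
    define m where "m = jump_or_deadline \<tau> T \<omega>1"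
    have m1: "m = min (first_jump_after s \<omega>1) d"
      and m2: "jump_or_deadline \<tau> T \<omega>2 = min (first_jump_after s \<omega>2) d"
      using real by (simp_all add: m_def d_def jump_or_deadline_def \<tau>12)
    have "ereal s \<le> m"
      using le_jump_or_deadline[OF \<tau> T, of \<omega>1] real by (simp add: m_def)
    then have same: "N r \<omega>1 = N r \<omega>2" if "0 \<le> r" "ereal r \<le> m" for r
      using agree that by (simp add: agree_upto_def m_def)
    (* A first jump up to time m of either path is also a jump of the other path. *)
    have *: "first_jump_after s \<omega>' \<le> first_jump_after s \<omega>"
      if jump: "first_jump_after s \<omega> \<le> m" "first_jump_after s \<omega> < \<infinity>"
        and N: "\<And>r. 0 \<le> r \<Longrightarrow> ereal r \<le> m \<Longrightarrow> N r \<omega>' = N r \<omega>" for \<omega> \<omega>'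
    proof -
      obtain p where p: "first_jump_after s \<omega> = ereal p"
        using jump(2) le_first_jump_after[of s \<omega>] by (cases "first_jump_after s \<omega>") auto
      then have "s < p" "N p \<omega> = N s \<omega> + 1"
        using N_at_first_jump[OF \<open>0 \<le> s\<close>] by auto
      then have "first_jump_after s \<omega>' \<le> ereal p"
        using jump(1) N p \<open>0 \<le> s\<close> \<open>ereal s \<le> m\<close> by (intro first_jump_after_le) auto
      with p show ?thesis by simp
    qed
    have "m \<le> min (first_jump_after s \<omega>2) d"
    proof (rule ccontr)
      assume "\<not> m \<le> min (first_jump_after s \<omega>2) d"
      moreover have "m \<le> d"
        by (simp add: m1)
      ultimately have "first_jump_after s \<omega>2 < m"
        by (simp add: not_le)
      moreover from calculation have "first_jump_after s \<omega>1 \<le> first_jump_after s \<omega>2"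
        by (intro *) (auto simp: same)
      ultimately show False by (auto simp: m1)
    qed
    moreover have "min (first_jump_after s \<omega>2) d \<le> m"
    proof (cases "first_jump_after s \<omega>1 \<le> d \<and> first_jump_after s \<omega>1 < \<infinity>")
      case True
      then have "first_jump_after s \<omega>2 \<le> first_jump_after s \<omega>1"
        by (intro *) (auto simp: m1 same[unfolded m1])
      then show ?thesis
        by (auto simp: m1 min_le_iff_disj)
    next
      case False
      then have "m = d"
        by (auto simp: m1)
      then show ?thesis by simp
    qed
    ultimately show ?thesis
      using m2 m_def by (metis antisym)
  next
    case PInf
    then show ?thesis by (simp add: jump_or_deadline_def \<tau>12)
  next
    case MInf
    then show ?thesis using stopping_time_nonneg[OF \<tau>, of \<omega>1] by simp
  qed
qed

definition jump_bet :: "(path \<Rightarrow> ereal) \<Rightarrow> ereal \<Rightarrow> real \<Rightarrow> real \<Rightarrow> strategy" where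
  "jump_bet \<tau> T up low =
     \<lparr>rounds = 1, times = (\<lambda>k. if k = 1 then \<tau> else jump_or_deadline \<tau> T),
      upper_stake = (\<lambda>_ _. Some up), lower_stake = (\<lambda>_ _. Some low)\<rparr>"

lemma elementary_strategy_jump_bet:
  assumes "stopping_time \<tau>" "0 \<le> T" "0 \<le> up" "0 \<le> low"
  shows "elementary_strategy (jump_bet \<tau> T up low)"
  using assms
  by (auto simp: elementary_strategy_def jump_bet_def stopping_time_jump_or_deadline
      le_jump_or_deadline is_stake_def measurable_at_def ran_def)

lemma capital_jump_bet_before:
  assumes "stopping_time \<tau>" "0 \<le> T" "ereal t \<le> \<tau> \<omega>"
  shows "capital lo hi (jump_bet \<tau> T up low) c t \<omega> = c"
proof -
  have "ereal t \<le> jump_or_deadline \<tau> T \<omega>"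
    using assms le_jump_or_deadline order_trans by blast
  then show ?thesis
    using assms(3) by (simp add: capital_def jump_bet_def round_gain_def stopped_def min_absorb2)
qed

lemma capital_jump_bet_after:
  assumes \<tau>: "stopping_time \<tau>" "0 \<le> T" and s: "\<tau> \<omega> = ereal s" "s \<le> t"
    and e: "ereal e = min (min (first_jump_after s \<omega>) (ereal s + T)) (ereal t)"
    and j: "j = (if first_jump_after s \<omega> \<le> ereal e then 1 else 0)"
  shows "capital lo hi (jump_bet \<tau> T up low) c t \<omega> =
    c + up * (j - hi * (e - s)) + low * (lo * (e - s) - j)"
proof -
  have "0 \<le> s"
    using stopping_time_nonneg[OF \<tau>(1), of \<omega>] s by simp
  have "ereal e \<le> first_jump_after s \<omega>"
    unfolding e by (auto simp: min_le_iff_disj)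
  have "ereal s \<le> ereal e"
    unfolding e using s(2) \<open>0 \<le> T\<close> le_first_jump_after[of s \<omega>] by (cases T) auto
  then have "s \<le> e" by simp
  have "N e \<omega> = N s \<omega> + (if first_jump_after s \<omega> \<le> ereal e then 1 else 0)"
  proof (cases "first_jump_after s \<omega> \<le> ereal e")
    case True
    then have "first_jump_after s \<omega> = ereal e"
      using \<open>ereal e \<le> first_jump_after s \<omega>\<close> by (rule antisym)
    then show ?thesis
      using N_at_first_jump[OF \<open>0 \<le> s\<close>] by simp
  next
    case False
    then show ?thesis
      using N_before_first_jump[OF \<open>0 \<le> s\<close> \<open>s \<le> e\<close>, of \<omega>] by simp
  qed
  then have "real (N e \<omega>) - real (N s \<omega>) = j"
    by (simp add: j)
  moreover have "stopped \<tau> t \<omega> = s"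
    using s by (simp add: stopped_eq)
  moreover have "stopped (jump_or_deadline \<tau> T) t \<omega> = e"
    using s by (simp add: stopped_def jump_or_deadline_def flip: e)
  ultimately show ?thesis
    by (simp add: capital_def jump_bet_def round_gain_eq Let_def algebra_simps)
qed

section \<open>Expectations\<close>

lemma process_infI:
  assumes "\<And>t \<omega>. 0 \<le> t \<Longrightarrow> C \<le> K t \<omega>"
  shows "process_inf K > -\<infinity>"
proof -
  have "ereal C \<le> process_inf K"
    unfolding process_inf_def using assms by (auto intro!: INF_greatest)
  then show ?thesis
    by (cases "process_inf K") auto
qed

lemma process_infD:
  assumes "process_inf K > -\<infinity>"
  obtains C where "\<And>t \<omega>. 0 \<le> t \<Longrightarrow> C \<le> K t \<omega>"
proof -
  obtain C where C: "ereal C < process_inf K"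
    using ereal_dense2[OF assms] by blast
  have "C \<le> K t \<omega>" if "0 \<le> t" for t \<omega>
  proof -
    have "process_inf K \<le> ereal (K t \<omega>)"
      unfolding process_inf_def by (rule INF_lower2[of "(t, \<omega>)"]) (use that in auto)
    with C have "ereal C < ereal (K t \<omega>)" by (rule less_le_trans)
    then show ?thesis by simp
  qed
  then show ?thesis by (rule that)
qed

lemma process_liminf_ge:
  assumes "\<And>t. t0 \<le> t \<Longrightarrow> x \<le> ereal (K t \<omega>)"
  shows "x \<le> process_liminf K \<omega>"
  unfolding process_liminf_def
  by (intro Liminf_bounded eventually_mono[OF eventually_ge_at_top[of t0]] assms)

lemma process_liminf_le:
  assumes "\<And>t. t0 \<le> t \<Longrightarrow> ereal (K t \<omega>) \<le> x"
  shows "process_liminf K \<omega> \<le> x"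
proof -
  have "process_liminf K \<omega> \<le> Limsup at_top (\<lambda>t. ereal (K t \<omega>))"
    unfolding process_liminf_def by (rule Liminf_le_Limsup) simp
  also have "\<dots> \<le> x"
    by (intro Limsup_bounded eventually_mono[OF eventually_ge_at_top[of t0]] assms)
  finally show ?thesis .
qed

lemma info_set_same_time:
  "stopping_time \<tau> \<Longrightarrow> \<omega>' \<in> info_set \<tau> \<omega> \<Longrightarrow> \<tau> \<omega>' = \<tau> \<omega>"
  by (auto simp: info_set_def intro: stopping_time_agree)

lemma upper_expectation_le:
  assumes "elementary_strategy G" "\<tau> \<omega> = ereal s"
    and "\<And>t \<omega>. 0 \<le> t \<Longrightarrow> C \<le> capital lo hi G c t \<omega>"
    and "\<And>\<omega>'. \<omega>' \<in> info_set \<tau> \<omega> \<Longrightarrow> the (f \<omega>') \<le> process_liminf (capital lo hi G c) \<omega>'"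
  shows "upper_expectation lo hi f \<tau> \<omega> \<le> ereal (capital lo hi G c s \<omega>)"
proof -
  have "process_inf (capital lo hi G c) > -\<infinity>"
    using assms(3) by (rule process_infI)
  then show ?thesis
    unfolding upper_expectation_def
    by (intro Inf_lower CollectI exI[of _ "capital lo hi G c"])
      (use assms in \<open>auto simp: process_at_def capital_processes_def\<close>)
qed

lemma upper_expectation_ge:
  assumes "\<tau> \<omega> = ereal s"
    and "\<And>G c C. elementary_strategy G \<Longrightarrow> (\<And>t \<omega>. 0 \<le> t \<Longrightarrow> C \<le> capital lo hi G c t \<omega>) \<Longrightarrow>
      (\<And>\<omega>'. \<omega>' \<in> info_set \<tau> \<omega> \<Longrightarrow> the (f \<omega>') \<le> process_liminf (capital lo hi G c) \<omega>') \<Longrightarrow>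
      x \<le> ereal (capital lo hi G c s \<omega>)"
  shows "x \<le> upper_expectation lo hi f \<tau> \<omega>"
  unfolding upper_expectation_def
proof (rule Inf_greatest, clarify)
  fix K
  assume K: "K \<in> capital_processes lo hi" "process_inf K > -\<infinity>"
    "\<forall>\<omega>'\<in>info_set \<tau> \<omega>. the (f \<omega>') \<le> process_liminf K \<omega>'"
  then obtain G c where "K = capital lo hi G c" "elementary_strategy G"
    by (auto simp: capital_processes_def)
  moreover obtain C where "\<And>t \<omega>. 0 \<le> t \<Longrightarrow> C \<le> K t \<omega>"
    using process_infD[OF K(2)] by blast
  ultimately show "x \<le> ereal (process_at K \<tau> \<omega>)"
    using assms(2)[of G C c] K(3) assms(1) by (simp add: process_at_def)
qed

text \<open>
  A superhedge is only required to dominate in the limit. Continuing the path that jumps at \<open>u\<close>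
  by \<open>no_arbitrage\<close> shows that the capital is already large enough at the time of the jump.
\<close>

lemma capital_ge_of_superhedge:
  assumes G: "elementary_strategy G" and lo: "0 \<le> lo" "lo \<le> \<mu>" "\<mu> \<le> hi" and "0 < \<mu>"
    and "0 \<le> s"
    and below: "\<And>t \<omega>. 0 \<le> t \<Longrightarrow> C \<le> capital lo hi G c t \<omega>"
    and superhedge: "\<And>\<omega>' u. agree_upto (ereal s) \<omega> \<omega>' \<Longrightarrow> first_jump_after s \<omega>' = ereal u \<Longrightarrow>
      ereal (\<sigma> * (u - s)) \<le> process_liminf (capital lo hi G c) \<omega>'"
  shows "\<sigma> / \<mu> \<le> capital lo hi G c s \<omega>"
proof (rule capital_ge_of_jump_bound[OF G lo \<open>0 < \<mu>\<close> \<open>0 \<le> s\<close> below])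
  fix u assume "s < u"
  let ?\<omega> = "continue_at_rate s (1 / (u - s)) \<omega>"
  show "\<sigma> * (u - s) \<le> capital lo hi G c u ?\<omega>"
  proof (rule field_le_epsilon)
    fix \<epsilon> :: real assume "0 < \<epsilon>"
    obtain \<omega>' where \<omega>': "agree_upto (ereal u) ?\<omega> \<omega>'"
      "\<And>t. u \<le> t \<Longrightarrow> capital lo hi G c t \<omega>' \<le> capital lo hi G c u ?\<omega> + \<epsilon>"
      using no_arbitrage[OF G lo(1) order_trans[OF lo(2,3)], of u \<epsilon>] \<open>0 < \<epsilon>\<close> \<open>0 \<le> s\<close> \<open>s < u\<close>
      by auto
    have N: "N r \<omega>' = N r ?\<omega>" if "0 \<le> r" "r \<le> u" for r
      using \<omega>'(1) that by (simp add: agree_upto_def)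
    have "agree_upto (ereal s) \<omega> \<omega>'"
      using \<open>0 \<le> s\<close> \<open>s < u\<close>
      by (intro agree_upto_trans[OF agree_upto_continue_at_rate agree_upto_mono[OF \<omega>'(1)]]) auto
    moreover have "first_jump_after s \<omega>' = ereal u"
      using \<open>0 \<le> s\<close> \<open>s < u\<close>
      by (intro first_jump_after_eqI) (auto simp: N N_one_jump_before N_one_jump_at)
    ultimately have "ereal (\<sigma> * (u - s)) \<le> process_liminf (capital lo hi G c) \<omega>'"
      by (rule superhedge)
    also have "\<dots> \<le> ereal (capital lo hi G c u ?\<omega> + \<epsilon>)"
      by (rule process_liminf_le[of u]) (use \<omega>'(2) in simp)
    finally show "\<sigma> * (u - s) \<le> capital lo hi G c u ?\<omega> + \<epsilon>"
      by simp
  qed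
qed

lemma upper_expectation_waiting_time_le:
  assumes "0 < lo" "stopping_time \<tau>" "\<tau> \<omega> = ereal s"
  shows "upper_expectation lo hi (waiting_time \<tau>) \<tau> \<omega> \<le> ereal (1 / lo)"
proof -
  define G where "G = jump_bet \<tau> \<infinity> 0 (1 / lo)"
  define K where "K = capital lo hi G (1 / lo)"
  have G: "elementary_strategy G"
    unfolding G_def using assms by (intro elementary_strategy_jump_bet) auto
  have K_before: "K t \<omega> = 1 / lo" if "ereal t \<le> \<tau> \<omega>" for t \<omega>
    unfolding K_def G_def using that assms by (intro capital_jump_bet_before) auto
  have K_after: "K t \<omega> = (if first_jump_after s \<omega> \<le> ereal t
      then real_of_ereal (first_jump_after s \<omega>) - s else 1 / lo + (t - s))"
    if "\<tau> \<omega> = ereal s" "s \<le> t" for t s \<omega>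
  proof -
    let ?e = "real_of_ereal (min (first_jump_after s \<omega>) (ereal t))"
    have e: "ereal ?e = min (min (first_jump_after s \<omega>) (ereal s + \<infinity>)) (ereal t)"
      using le_first_jump_after[of s \<omega>]
      by (cases "first_jump_after s \<omega>") (auto simp: min_def)
    have "K t \<omega> = 1 / lo + 0 * ((if first_jump_after s \<omega> \<le> ereal ?e then 1 else 0) - hi * (?e - s)) +
      1 / lo * (lo * (?e - s) - (if first_jump_after s \<omega> \<le> ereal ?e then 1 else 0))"
      unfolding K_def G_def by (rule capital_jump_bet_after[OF assms(2) _ that e refl]) simp
    then show ?thesis
      using \<open>0 < lo\<close> le_first_jump_after[of s \<omega>]
      by (cases "first_jump_after s \<omega>") (auto simp: min_def right_diff_distrib)
  qed
  have K_nonneg: "0 \<le> K t \<omega>" if "0 \<le> t" for t \<omega>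
  proof (cases "ereal t \<le> \<tau> \<omega>")
    case True
    then show ?thesis using K_before \<open>0 < lo\<close> by simp
  next
    case False
    then obtain s where s: "\<tau> \<omega> = ereal s" "s \<le> t"
      using stopping_time_nonneg[OF assms(2), of \<omega>] by (cases "\<tau> \<omega>") auto
    then show ?thesis
      using K_after[OF s] le_first_jump_after[of s \<omega>] \<open>0 < lo\<close>
      by (cases "first_jump_after s \<omega>") auto
  qed
  have "upper_expectation lo hi (waiting_time \<tau>) \<tau> \<omega> \<le> ereal (K s \<omega>)"
    unfolding K_def
  proof (rule upper_expectation_le[where \<tau> = \<tau> and \<omega> = \<omega>, OF G assms(3)])
    show "0 \<le> capital lo hi G (1 / lo) t \<omega>" if "0 \<le> t" for t \<omega>
      using K_nonneg[OF that] by (simp add: K_def)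
    fix \<omega>' assume "\<omega>' \<in> info_set \<tau> \<omega>"
    then have s: "\<tau> \<omega>' = ereal s"
      using info_set_same_time[OF assms(2)] assms(3) by simp
    have "first_jump_after s \<omega>' - ereal s \<le> process_liminf K \<omega>'"
    proof (cases "first_jump_after s \<omega>'")
      case (real p)
      then show ?thesis
        using le_first_jump_after[of s \<omega>']
        by (intro process_liminf_ge[of p]) (simp add: K_after[OF s])
    next
      case PInf
      have "ereal x \<le> process_liminf K \<omega>'" for x
        using \<open>0 < lo\<close> PInf
        by (intro process_liminf_ge[of "max s (x + s)"])
          (auto simp: K_after[OF s] add_increasing)
      then show ?thesis
        using ereal_top by fastforce
    next
      case MInf
      then show ?thesis using le_first_jump_after[of s \<omega>'] by simp
    qed
    then show "the (waiting_time \<tau> \<omega>') \<le> process_liminf (capital lo hi G (1 / lo)) \<omega>'"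
      by (simp add: waiting_time_eq[where \<tau> = \<tau> and \<omega> = \<omega>', OF s] K_def)
  qed
  then show ?thesis
    using K_before[of s \<omega>] assms(3) by simp
qed

text \<open>
  With \<open>h = T / (1 + hi * T)\<close>, a jump before the deadline leaves the capital
  \<open>- (h * hi) * (\<rho> - s)\<close>, where \<open>h * hi < 1\<close>. Without a jump the capital is \<open>- h - h * hi * T\<close> at the
  deadline, and \<open>h\<close> is chosen to make this equal to \<open>-T\<close>. The argument includes \<open>hi = 0\<close>, where
  \<open>h = T\<close> can be arbitrarily large.
\<close>

lemma upper_expectation_neg_waiting_time_le:
  assumes "0 \<le> hi" "stopping_time \<tau>" "\<tau> \<omega> = ereal s" "0 < T"
  shows "upper_expectation lo hi (\<lambda>\<omega>'. map_option uminus (waiting_time \<tau> \<omega>')) \<tau> \<omega>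
    \<le> ereal (- T / (1 + hi * T))"
proof -
  define h where "h = T / (1 + hi * T)"
  define G where "G = jump_bet \<tau> (ereal T) h 0"
  define K where "K = capital lo hi G (- h)"
  have "0 < 1 + hi * T"
    using assms by (simp add: add_pos_nonneg)
  then have "0 \<le> h" "h * (1 + hi * T) = T" "h * hi \<le> 1"
    using assms by (simp_all add: h_def divide_le_eq_1 mult.commute)
  then have h: "0 \<le> h" "h + h * hi * T = T" "h * hi \<le> 1"
    by (simp_all add: algebra_simps)
  have G: "elementary_strategy G"
    unfolding G_def using assms h by (intro elementary_strategy_jump_bet) auto
  have K_before: "K t \<omega> = - h" if "ereal t \<le> \<tau> \<omega>" for t \<omega>
    unfolding K_def G_def using that assms by (intro capital_jump_bet_before) auto
  have K_after: "K t \<omega> = (if first_jump_after s \<omega> \<le> ereal (min (s + T) t)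
      then - (h * hi * (real_of_ereal (first_jump_after s \<omega>) - s))
      else - h - h * hi * (min (s + T) t - s))"
    if "\<tau> \<omega> = ereal s" "s \<le> t" for t s \<omega>
  proof -
    let ?e = "real_of_ereal (min (first_jump_after s \<omega>) (ereal (min (s + T) t)))"
    have e: "ereal ?e = min (min (first_jump_after s \<omega>) (ereal s + ereal T)) (ereal t)"
      using le_first_jump_after[of s \<omega>]
      by (cases "first_jump_after s \<omega>") (auto simp: min_def)
    have "K t \<omega> = - h + h * ((if first_jump_after s \<omega> \<le> ereal ?e then 1 else 0) - hi * (?e - s)) +
      0 * (lo * (?e - s) - (if first_jump_after s \<omega> \<le> ereal ?e then 1 else 0))"
      unfolding K_def G_def
      by (rule capital_jump_bet_after[OF assms(2) _ that e refl]) (use assms in simp)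
    then show ?thesis
      using le_first_jump_after[of s \<omega>]
      by (cases "first_jump_after s \<omega>") (auto simp: min_def algebra_simps)
  qed
  have K_ge: "- T \<le> K t \<omega>" if "0 \<le> t" for t \<omega>
  proof (cases "ereal t \<le> \<tau> \<omega>")
    case True
    have "0 \<le> h * hi * T"
      using h assms by simp
    with True show ?thesis using K_before h by simp
  next
    case False
    then obtain s where s: "\<tau> \<omega> = ereal s" "s \<le> t"
      using stopping_time_nonneg[OF assms(2), of \<omega>] by (cases "\<tau> \<omega>") auto
    have *: "h * hi * y \<le> h * hi * T" if "y \<le> T" for y
      using that h assms by (intro mult_left_mono) auto
    show ?thesis
    proof (cases "first_jump_after s \<omega> \<le> ereal (min (s + T) t)")
      case True
      then obtain p where "first_jump_after s \<omega> = ereal p"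
        using le_first_jump_after[of s \<omega>] by (cases "first_jump_after s \<omega>") auto
      then show ?thesis
        using K_after[OF s] True *[of "p - s"] h by simp
    next
      case False
      then have "K t \<omega> = - h - h * hi * (min (s + T) t - s)"
        unfolding K_after[OF s] by (rule if_not_P)
      moreover have "h * hi * (min (s + T) t - s) \<le> h * hi * T"
        by (rule *) (auto simp: min_def)
      ultimately show ?thesis
        using h(2) by linarith
    qed
  qed
  have "upper_expectation lo hi (\<lambda>\<omega>'. map_option uminus (waiting_time \<tau> \<omega>')) \<tau> \<omega> \<le> ereal (K s \<omega>)"
    unfolding K_def
  proof (rule upper_expectation_le[where \<tau> = \<tau> and \<omega> = \<omega>, OF G assms(3)])
    show "- T \<le> capital lo hi G (- h) t \<omega>" if "0 \<le> t" for t \<omega>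
      using K_ge[OF that] by (simp add: K_def)
    fix \<omega>' assume "\<omega>' \<in> info_set \<tau> \<omega>"
    then have s: "\<tau> \<omega>' = ereal s"
      using info_set_same_time[OF assms(2)] assms(3) by simp
    have "- (first_jump_after s \<omega>' - ereal s) \<le> process_liminf K \<omega>'"
    proof (rule process_liminf_ge[of "s + T"])
      fix t assume t: "s + T \<le> t"
      show "- (first_jump_after s \<omega>' - ereal s) \<le> ereal (K t \<omega>')"
      proof (cases "first_jump_after s \<omega>' \<le> ereal (s + T)")
        case True
        then obtain p where p: "first_jump_after s \<omega>' = ereal p" "s \<le> p"
          using le_first_jump_after[of s \<omega>'] by (cases "first_jump_after s \<omega>'") auto
        have "h * hi * (p - s) \<le> 1 * (p - s)"
          using h p by (intro mult_right_mono) auto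
        then show ?thesis
          using K_after[OF s, of t] True p t assms(4) by (simp add: min_absorb1)
      next
        case False
        then have "K t \<omega>' = - T"
          using K_after[OF s, of t] t assms(4) h by (simp add: min_absorb1)
        then show ?thesis
          using False by (cases "first_jump_after s \<omega>'") auto
      qed
    qed
    then show "the (map_option uminus (waiting_time \<tau> \<omega>'))
        \<le> process_liminf (capital lo hi G (- h)) \<omega>'"
      by (simp add: waiting_time_eq[where \<tau> = \<tau> and \<omega> = \<omega>', OF s] K_def)
  qed
  then show ?thesis
    using K_before[of s \<omega>] assms(3) by (simp add: h_def)
qed

lemma upper_expectation_waiting_time_ge:
  assumes lo: "0 < lo" "lo \<le> hi" and \<tau>: "stopping_time \<tau>" "\<tau> \<omega> = ereal s"
  shows "ereal (1 / lo) \<le> upper_expectation lo hi (waiting_time \<tau>) \<tau> \<omega>"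
proof (rule upper_expectation_ge[where \<tau> = \<tau> and \<omega> = \<omega>, OF \<tau>(2)])
  fix G c C
  assume G: "elementary_strategy G" "\<And>t \<omega>. 0 \<le> t \<Longrightarrow> C \<le> capital lo hi G c t \<omega>"
    and hedge: "\<And>\<omega>'. \<omega>' \<in> info_set \<tau> \<omega> \<Longrightarrow>
      the (waiting_time \<tau> \<omega>') \<le> process_liminf (capital lo hi G c) \<omega>'"
  have "0 \<le> s"
    using stopping_time_nonneg[OF \<tau>(1), of \<omega>] \<tau>(2) by simp
  have "1 / lo \<le> capital lo hi G c s \<omega>"
  proof (rule capital_ge_of_superhedge[OF G(1) _ order_refl lo(2,1) \<open>0 \<le> s\<close> G(2)])
    fix \<omega>' u
    assume \<omega>': "agree_upto (ereal s) \<omega> \<omega>'" "first_jump_after s \<omega>' = ereal u"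
    then have "\<omega>' \<in> info_set \<tau> \<omega>" "\<tau> \<omega>' = ereal s"
      using \<tau> stopping_time_agree[OF \<tau>(1), of \<omega> \<omega>'] by (simp_all add: info_set_def)
    then show "ereal (1 * (u - s)) \<le> process_liminf (capital lo hi G c) \<omega>'"
      using hedge[of \<omega>'] \<omega>'(2) by (simp add: waiting_time_eq)
  qed (use lo in auto)
  then show "ereal (1 / lo) \<le> ereal (capital lo hi G c s \<omega>)" by simp
qed

lemma upper_expectation_neg_waiting_time_ge:
  assumes lo: "0 \<le> lo" "lo \<le> hi" "0 < hi" and \<tau>: "stopping_time \<tau>" "\<tau> \<omega> = ereal s"
  shows "ereal (- 1 / hi) \<le>
    upper_expectation lo hi (\<lambda>\<omega>'. map_option uminus (waiting_time \<tau> \<omega>')) \<tau> \<omega>"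
proof (rule upper_expectation_ge[where \<tau> = \<tau> and \<omega> = \<omega>, OF \<tau>(2)])
  fix G c C
  assume G: "elementary_strategy G" "\<And>t \<omega>. 0 \<le> t \<Longrightarrow> C \<le> capital lo hi G c t \<omega>"
    and hedge: "\<And>\<omega>'. \<omega>' \<in> info_set \<tau> \<omega> \<Longrightarrow>
      the (map_option uminus (waiting_time \<tau> \<omega>')) \<le> process_liminf (capital lo hi G c) \<omega>'"
  have "0 \<le> s"
    using stopping_time_nonneg[OF \<tau>(1), of \<omega>] \<tau>(2) by simp
  have "- 1 / hi \<le> capital lo hi G c s \<omega>"
  proof (rule capital_ge_of_superhedge[OF G(1) lo(1,2) order_refl lo(3) \<open>0 \<le> s\<close> G(2)])
    fix \<omega>' u
    assume \<omega>': "agree_upto (ereal s) \<omega> \<omega>'" "first_jump_after s \<omega>' = ereal u"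
    then have "\<omega>' \<in> info_set \<tau> \<omega>" "\<tau> \<omega>' = ereal s"
      using \<tau> stopping_time_agree[OF \<tau>(1), of \<omega> \<omega>'] by (simp_all add: info_set_def)
    then show "ereal (- 1 * (u - s)) \<le> process_liminf (capital lo hi G c) \<omega>'"
      using hedge[of \<omega>'] \<omega>'(2) by (simp add: waiting_time_eq)
  qed
  then show "ereal (- 1 / hi) \<le> ereal (capital lo hi G c s \<omega>)" by simp
qed

lemma upper_expectation_waiting_time_zero_rate:
  assumes "0 \<le> hi" and \<tau>: "stopping_time \<tau>" "\<tau> \<omega> = ereal s"
  shows "upper_expectation 0 hi (waiting_time \<tau>) \<tau> \<omega> = \<infinity>"
proof -
  have "\<infinity> \<le> upper_expectation 0 hi (waiting_time \<tau>) \<tau> \<omega>"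
  proof (rule upper_expectation_ge[where \<tau> = \<tau> and \<omega> = \<omega>, OF \<tau>(2)])
    fix G c
    assume G: "elementary_strategy G"
      and hedge: "\<And>\<omega>'. \<omega>' \<in> info_set \<tau> \<omega> \<Longrightarrow>
        the (waiting_time \<tau> \<omega>') \<le> process_liminf (capital 0 hi G c) \<omega>'"
    let ?\<omega> = "continue_at_rate s 0 \<omega>"
    have "0 \<le> s"
      using stopping_time_nonneg[OF \<tau>(1), of \<omega>] \<tau>(2) by simp
    then have "agree_upto (\<tau> \<omega>) \<omega> ?\<omega>"
      using agree_upto_continue_at_rate[of s 0 \<omega>] \<tau>(2) by simp
    then have "?\<omega> \<in> info_set \<tau> \<omega>" "\<tau> ?\<omega> = ereal s"
      using \<tau> stopping_time_agree[OF \<tau>(1), of \<omega> ?\<omega>] by (simp_all add: info_set_def)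
    then have "\<infinity> \<le> process_liminf (capital 0 hi G c) ?\<omega>"
      using hedge[of ?\<omega>] \<open>0 \<le> s\<close> by (simp add: waiting_time_eq first_jump_after_frozen)
    also have "\<dots> \<le> ereal (capital 0 hi G c s ?\<omega>)"
      by (rule process_liminf_le[of s])
        (simp add: capital_frozen_antitone[OF G \<open>0 \<le> s\<close> _ \<open>0 \<le> hi\<close>])
    finally show "\<infinity> \<le> ereal (capital 0 hi G c s \<omega>)"
      by simp
  qed
  then show ?thesis by simp
qed

theorem proposition6:
  fixes lam_lo lam_hi :: real and \<tau> :: "path \<Rightarrow> ereal" and \<omega> :: path
  assumes "0 \<le> lam_lo" and "lam_lo \<le> lam_hi"
    and "stopping_time \<tau>"
    and "\<omega> \<in> finite_event \<tau>"
  shows "upper_expectation lam_lo lam_hi (waiting_time \<tau>) \<tau> \<omega> = 1 / ereal lam_lo \<and>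
         lower_expectation lam_lo lam_hi (waiting_time \<tau>) \<tau> \<omega> = 1 / ereal lam_hi"
proof
  obtain s where s: "\<tau> \<omega> = ereal s"
    using assms(4) stopping_time_nonneg[OF assms(3), of \<omega>]
    by (cases "\<tau> \<omega>") (auto simp: finite_event_def)
  show "upper_expectation lam_lo lam_hi (waiting_time \<tau>) \<tau> \<omega> = 1 / ereal lam_lo"
  proof (cases "lam_lo = 0")
    case True
    then show ?thesis
      using upper_expectation_waiting_time_zero_rate[OF _ assms(3) s, of lam_hi] assms(2)
      by (simp add: zero_ereal_def divide_ereal_def)
  next
    case False
    then show ?thesis
      using assms upper_expectation_waiting_time_le[OF _ assms(3) s, of lam_lo lam_hi]
        upper_expectation_waiting_time_ge[OF _ assms(2,3) s]
      by (simp add: one_ereal_def antisym)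
  qed
  define U where "U = upper_expectation lam_lo lam_hi
    (\<lambda>\<omega>'. map_option uminus (waiting_time \<tau> \<omega>')) \<tau> \<omega>"
  have U_le: "U \<le> ereal (- T / (1 + lam_hi * T))" if "0 < T" for T
    unfolding U_def using upper_expectation_neg_waiting_time_le[OF _ assms(3) s that] assms by simp
  have "U = - (1 / ereal lam_hi)"
  proof (cases "lam_hi = 0")
    case True
    have "U \<le> ereal x" for x
    proof -
      have "U \<le> ereal (- max 1 (- x))"
        using U_le[of "max 1 (- x)"] True by simp
      also have "\<dots> \<le> ereal x" by simp
      finally show ?thesis .
    qed
    then have "U = -\<infinity>"
      by (rule ereal_bot)
    then show ?thesis
      using True by (simp add: zero_ereal_def divide_ereal_def)
  next
    case False
    then have "0 < lam_hi"
      using assms by simp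
    then have "((\<lambda>T. - T / (1 + lam_hi * T)) \<longlongrightarrow> - inverse lam_hi) at_top"
      by real_asymp
    then have "((\<lambda>T. - T / (1 + lam_hi * T)) \<longlongrightarrow> - 1 / lam_hi) at_top"
      by (simp add: divide_inverse)
    then have "((\<lambda>T. ereal (- T / (1 + lam_hi * T))) \<longlongrightarrow> ereal (- 1 / lam_hi)) at_top"
      by simp
    moreover have "eventually (\<lambda>T. U \<le> ereal (- T / (1 + lam_hi * T))) at_top"
      using eventually_gt_at_top[of 0] by (rule eventually_mono) (rule U_le)
    ultimately have "U \<le> ereal (- 1 / lam_hi)"
      by (rule tendsto_lowerbound) simp
    moreover have "ereal (- 1 / lam_hi) \<le> U"
      unfolding U_def
      by (rule upper_expectation_neg_waiting_time_ge[OF assms(1,2) \<open>0 < lam_hi\<close> assms(3) s])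
    ultimately have "U = ereal (- 1 / lam_hi)"
      by (rule antisym)
    then show ?thesis
      using False by (metis divide_minus_left ereal_divide one_ereal_def uminus_ereal.simps(1))
  qed
  then show "lower_expectation lam_lo lam_hi (waiting_time \<tau>) \<tau> \<omega> = 1 / ereal lam_hi"
    by (simp add: lower_expectation_def U_def)
qed

end
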